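(* Under the standing assumptions in the context, there are constants $c_7,c_8,c_9>0$ such that whenever $\mathcal F\in\mathcal W'$, $(\mathbf u,p)\in\mathcal W$ and $\mathcal A(\mathbf u,p)=\mathcal F$, with $\beta=\|\pi_1\mathcal F\|_{V'}$ and $\gamma=\|\pi_2\mathcal F\|_{Z'}$, one has $$\|\mathbf u\|_{L^s}\le c_7(\beta^{r-1}+\gamma^{r-1}+\gamma),\quad \|\operatorname{div}\mathbf u\|_{L^s}\le c_7\gamma,\quad \|p\|_{Z}\le c_7(\gamma^{r-1}+\gamma^{s-1}+\beta^{r-1}+\beta),$$ $$\|(\mathbf u,p)\|_{\mathcal W}\le c_8(\gamma^{r-1}+\gamma^{s-1}+\beta^{r-1}+\beta),\qquad \|(\mathbf u,p)\|_{\mathcal W}\le c_9(\|\mathcal F\|_{\mathcal W'}^{r-1}+\|\mathcal F\|_{\mathcal W'}^{s-1}).$$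
   Context: $n\ge2$, $\Omega\subset\mathbb R^n$ open bounded with $C^1$ boundary. $F:\mathbb R^n\to\mathbb R^n$ satisfies $F(0)=0$ and, for constants $s>2$, $c_1,c_2>0$ and all $x,y$: $|F(x)-F(y)|\le c_1(1+|x|^{s-2}+|y|^{s-2})|x-y|$ and $(F(x)-F(y))\cdot(x-y)\ge c_2|x-y|^s$. Let $r=s/(s-1)$. $V=\mathbf W_s(\mathrm{div},\Omega)=\{\mathbf v\in(L^s(\Omega))^n:\operatorname{div}\mathbf v\in L^s(\Omega)\}$ with norm $(\|\mathbf v\|_{L^s}^s+\|\operatorname{div}\mathbf v\|_{L^s}^s)^{1/s}$, $Z=L^r(\Omega)$, and $\mathcal W=V\times Z$ with norm $\|(\mathbf u,p)\|_{\mathcal W}=\|\mathbf u\|_V+\|p\|_Z$. Set $a(\mathbf u,\mathbf v)=\int_\Omega F(\mathbf u)\cdot\mathbf v\,dx$, $b(\mathbf v,q)=\int_\Omega(\operatorname{div}\mathbf v)q\,dx$, and $\mathcal A:\mathcal W\to\mathcal W'$ by $\langle\mathcal A(\mathbf u,p),(\mathbf v,q)\rangle=a(\mathbf u,\mathbf v)-b(\mathbf v,p)+b(\mathbf u,q)$. For $\mathcal F\in\mathcal W'$, $\pi_1\mathcal F\in V'$ and $\pi_2\mathcal F\in Z'$ are $(\pi_1\mathcal F)(\mathbf v)=\mathcal F(\mathbf v,0)$ and $(\pi_2\mathcal F)(q)=\mathcal F(0,q)$. *)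

theory Defs
  imports "HOL-Analysis.Analysis"
begin

fun Ck :: "nat \<Rightarrow> ('a::euclidean_space \<Rightarrow> real) \<Rightarrow> 'a set \<Rightarrow> bool" where
  "Ck 0 f S = continuous_on S f"
| "Ck (Suc k) f S = (f differentiable_on S \<and>
      (\<forall>i\<in>Basis. Ck k (\<lambda>x. frechet_derivative f (at x) i) S))"

definition smooth_fun :: "('a::euclidean_space \<Rightarrow> real) \<Rightarrow> bool" where
  "smooth_fun f \<longleftrightarrow> (\<forall>k. Ck k f UNIV)"

definition test_fun :: "'a::euclidean_space set \<Rightarrow> ('a \<Rightarrow> real) \<Rightarrow> bool" where
  "test_fun \<Omega> \<phi> \<longleftrightarrow> smooth_fun \<phi> \<and> compact (closure {x. \<phi> x \<noteq> 0})
      \<and> closure {x. \<phi> x \<noteq> 0} \<subseteq> \<Omega>"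

(* open set with C^1 boundary: locally, after choosing a unit direction e,
   \<Omega> is the supergraph of a C^1 function of the coordinates orthogonal to e *)
definition C1_boundary :: "'a::euclidean_space set \<Rightarrow> bool" where
  "C1_boundary \<Omega> \<longleftrightarrow> (\<forall>x0\<in>frontier \<Omega>. \<exists>\<rho>>0. \<exists>e h. norm e = 1 \<and> Ck 1 h UNIV \<and>
      (\<forall>x\<in>ball x0 \<rho>. x \<in> \<Omega> \<longleftrightarrow> x \<bullet> e > h (x - (x \<bullet> e) *\<^sub>R e)))"

definition Lp :: "'a::euclidean_space set \<Rightarrow> real \<Rightarrow> ('a \<Rightarrow> 'b::real_normed_vector) \<Rightarrow> bool" where
  "Lp \<Omega> p f \<longleftrightarrow> f \<in> borel_measurable (lebesgue_on \<Omega>) \<and>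
      integrable (lebesgue_on \<Omega>) (\<lambda>x. norm (f x) powr p)"

definition Lnorm :: "'a::euclidean_space set \<Rightarrow> real \<Rightarrow> ('a \<Rightarrow> 'b::real_normed_vector) \<Rightarrow> real" where
  "Lnorm \<Omega> p f = (\<integral>x. norm (f x) powr p \<partial>lebesgue_on \<Omega>) powr (1 / p)"

definition weak_div :: "'a::euclidean_space set \<Rightarrow> ('a \<Rightarrow> 'a) \<Rightarrow> ('a \<Rightarrow> real) \<Rightarrow> bool" where
  "weak_div \<Omega> v g \<longleftrightarrow> (\<forall>\<phi>. test_fun \<Omega> \<phi> \<longrightarrow>
      (\<integral>x. frechet_derivative \<phi> (at x) (v x) \<partial>lebesgue_on \<Omega>)
        = - (\<integral>x. g x * \<phi> x \<partial>lebesgue_on \<Omega>))"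

definition Vsp :: "'a::euclidean_space set \<Rightarrow> real \<Rightarrow> ('a \<Rightarrow> 'a) set" where
  "Vsp \<Omega> s = {v. Lp \<Omega> s v \<and> (\<exists>g. Lp \<Omega> s g \<and> weak_div \<Omega> v g)}"

definition wdiv :: "'a::euclidean_space set \<Rightarrow> real \<Rightarrow> ('a \<Rightarrow> 'a) \<Rightarrow> ('a \<Rightarrow> real)" where
  "wdiv \<Omega> s v = (SOME g. Lp \<Omega> s g \<and> weak_div \<Omega> v g)"

definition Vnorm :: "'a::euclidean_space set \<Rightarrow> real \<Rightarrow> ('a \<Rightarrow> 'a) \<Rightarrow> real" where
  "Vnorm \<Omega> s v = (Lnorm \<Omega> s v powr s + Lnorm \<Omega> s (wdiv \<Omega> s v) powr s) powr (1 / s)"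

definition conj_exp :: "real \<Rightarrow> real" where
  "conj_exp s = s / (s - 1)"

definition Wsp :: "'a::euclidean_space set \<Rightarrow> real \<Rightarrow> (('a \<Rightarrow> 'a) \<times> ('a \<Rightarrow> real)) set" where
  "Wsp \<Omega> s = Vsp \<Omega> s \<times> {q. Lp \<Omega> (conj_exp s) q}"

definition Wnorm :: "'a::euclidean_space set \<Rightarrow> real \<Rightarrow> ('a \<Rightarrow> 'a) \<times> ('a \<Rightarrow> real) \<Rightarrow> real" where
  "Wnorm \<Omega> s w = Vnorm \<Omega> s (fst w) + Lnorm \<Omega> (conj_exp s) (snd w)"

definition Wdual :: "'a::euclidean_space set \<Rightarrow> real \<Rightarrow> ((('a \<Rightarrow> 'a) \<times> ('a \<Rightarrow> real)) \<Rightarrow> real) set" where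
  "Wdual \<Omega> s = {G.
     (\<forall>v1 q1 v2 q2 a b. (v1, q1) \<in> Wsp \<Omega> s \<longrightarrow> (v2, q2) \<in> Wsp \<Omega> s \<longrightarrow>
        G (\<lambda>x. a *\<^sub>R v1 x + b *\<^sub>R v2 x, \<lambda>x. a * q1 x + b * q2 x) = a * G (v1, q1) + b * G (v2, q2))
     \<and> (\<exists>C. \<forall>w\<in>Wsp \<Omega> s. \<bar>G w\<bar> \<le> C * Wnorm \<Omega> s w)}"

definition Wdual_norm :: "'a::euclidean_space set \<Rightarrow> real \<Rightarrow> ((('a \<Rightarrow> 'a) \<times> ('a \<Rightarrow> real)) \<Rightarrow> real) \<Rightarrow> real" where
  "Wdual_norm \<Omega> s G = Sup ((\<lambda>w. \<bar>G w\<bar>) ` {w\<in>Wsp \<Omega> s. Wnorm \<Omega> s w \<le> 1})"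

definition pi1_norm :: "'a::euclidean_space set \<Rightarrow> real \<Rightarrow> ((('a \<Rightarrow> 'a) \<times> ('a \<Rightarrow> real)) \<Rightarrow> real) \<Rightarrow> real" where
  "pi1_norm \<Omega> s G = Sup ((\<lambda>v. \<bar>G (v, \<lambda>x. 0)\<bar>) ` {v\<in>Vsp \<Omega> s. Vnorm \<Omega> s v \<le> 1})"

definition pi2_norm :: "'a::euclidean_space set \<Rightarrow> real \<Rightarrow> ((('a \<Rightarrow> 'a) \<times> ('a \<Rightarrow> real)) \<Rightarrow> real) \<Rightarrow> real" where
  "pi2_norm \<Omega> s G = Sup ((\<lambda>q. \<bar>G (\<lambda>x. 0, q)\<bar>) `
      {q. Lp \<Omega> (conj_exp s) q \<and> Lnorm \<Omega> (conj_exp s) q \<le> 1})"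

definition form_a :: "'a::euclidean_space set \<Rightarrow> ('a \<Rightarrow> 'a) \<Rightarrow> ('a \<Rightarrow> 'a) \<Rightarrow> ('a \<Rightarrow> 'a) \<Rightarrow> real" where
  "form_a \<Omega> F u v = (\<integral>x. F (u x) \<bullet> v x \<partial>lebesgue_on \<Omega>)"

definition form_b :: "'a::euclidean_space set \<Rightarrow> real \<Rightarrow> ('a \<Rightarrow> 'a) \<Rightarrow> ('a \<Rightarrow> real) \<Rightarrow> real" where
  "form_b \<Omega> s v q = (\<integral>x. wdiv \<Omega> s v x * q x \<partial>lebesgue_on \<Omega>)"

definition opA :: "'a::euclidean_space set \<Rightarrow> real \<Rightarrow> ('a \<Rightarrow> 'a) \<Rightarrow> ('a \<Rightarrow> 'a) \<times> ('a \<Rightarrow> real)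
    \<Rightarrow> ('a \<Rightarrow> 'a) \<times> ('a \<Rightarrow> real) \<Rightarrow> real" where
  "opA \<Omega> s F w z = form_a \<Omega> F (fst w) (fst z) - form_b \<Omega> s (fst z) (snd w) + form_b \<Omega> s (fst w) (snd z)"

definition solves :: "'a::euclidean_space set \<Rightarrow> real \<Rightarrow> ('a \<Rightarrow> 'a) \<Rightarrow> ('a \<Rightarrow> 'a) \<times> ('a \<Rightarrow> real)
    \<Rightarrow> ((('a \<Rightarrow> 'a) \<times> ('a \<Rightarrow> real)) \<Rightarrow> real) \<Rightarrow> bool" where
  "solves \<Omega> s F w G \<longleftrightarrow> (\<forall>z\<in>Wsp \<Omega> s. opA \<Omega> s F w z = G z)"

end

theory Submission
  imports Defs
begin

text \<open>
  Testing the equation with \<open>(0, q)\<close> for \<open>q = |div u|\<^sup>s\<^sup>-\<^sup>2 div u\<close> bounds \<open>\<parallel>div u\<parallel>\<close> by \<open>\<gamma>\<close>.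
  The divergence has a bounded right inverse on \<open>L\<^sup>s(\<Omega>)\<close>: extend \<open>w\<close> by zero and integrate it along a
  coordinate direction.  Testing with \<open>(v, 0)\<close>, where \<open>div v = |p|\<^sup>r\<^sup>-\<^sup>2 p\<close>, then gives
  \<open>\<parallel>p\<parallel> \<le> K (\<parallel>u\<parallel> + \<parallel>u\<parallel>\<^sup>s\<^sup>-\<^sup>1 + \<beta>)\<close>, and testing with \<open>(u, 0)\<close> gives
  \<open>c\<^sub>2 \<parallel>u\<parallel>\<^sup>s \<le> \<beta> (\<parallel>u\<parallel> + \<parallel>div u\<parallel>) + \<parallel>div u\<parallel> \<parallel>p\<parallel>\<close>.  The three inequalities together imply all bounds.
  Because \<open>wdiv\<close> is chosen by Hilbert's epsilon, homogeneity of the norm of \<open>V\<close> and the identification of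
  \<open>div v\<close> rest on uniqueness of weak divergences, i.e. on the fundamental lemma of the calculus of variations.
\<close>

section \<open>Smooth bump functions on boxes\<close>

text \<open>Fields in V obey no boundary condition. Hence a right inverse of the divergence with one
  nonzero component is admissible, and testing controls \<open>p\<close> itself, not merely
  \<open>p\<close> up to a constant. The difficulty is a circularity: the bound for \<open>p\<close>
  contains the power s-1 of the norm N of \<open>u\<close>, while the energy inequality for N
  contains \<open>p\<close>. It closes because \<open>p\<close> enters there only multiplied by the
  norm of div u, which is at most \<gamma>. The worst term is therefore \<gamma> N^(s-1), of lower
  degree than N^s. This also explains the exponents, where r-1 = 1/(s-1). Balancing \<beta> N
  against N^s gives \<beta>^(r-1), balancing \<gamma> N gives \<gamma>^(r-1), and balancing \<gamma>
  N^(s-1) gives \<gamma>. Raising the result to the power s-1 produces \<beta>, \<gamma> and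
  \<gamma>^(s-1) in the bound for \<open>p\<close>. A technical obstacle recurs: the given functions
  are only Lebesgue measurable, whereas the Fubini and generator arguments run over Borel functions.
  Borel representatives mediate between the two.\<close>

definition flat_exp :: "nat \<Rightarrow> real \<Rightarrow> real" where
  "flat_exp m t = (if t \<le> 0 then 0 else inverse t ^ m / exp (inverse t))"

text \<open>The parameter \<open>m\<close> makes the classical function exp(-1/t) part of a family
  that is closed under differentiation up to linear combinations, so a single computation yields all
  derivatives.\<close>

lemma flat_exp_has_derivative:
  "(flat_exp m has_real_derivative flat_exp (m + 2) t - real m * flat_exp (m + 1) t) (at t)"
proof (cases t "0::real" rule: linorder_cases)
  case less
  have "((\<lambda>_. 0) has_real_derivative 0) (at t)" by simp
  moreover have "\<forall>\<^sub>F y in nhds t. flat_exp m y = 0"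
    using less by (auto simp: flat_exp_def intro!: eventually_nhds_in_open[of "{..<0}", THEN eventually_mono])
  ultimately have "(flat_exp m has_real_derivative 0) (at t)"
    using DERIV_cong_ev[OF refl, of "flat_exp m" "\<lambda>_. 0" t 0 0] by simp
  then show ?thesis using less by (simp add: flat_exp_def)
next
  case greater
  have "((\<lambda>t. inverse t ^ m / exp (inverse t)) has_real_derivative
      flat_exp (m + 2) t - real m * flat_exp (m + 1) t) (at t)"
    using greater power_minus_mult[of _ t]
    by (cases m) (auto intro!: derivative_eq_intros simp: flat_exp_def field_simps power2_eq_square, metis neq0_conv)
  moreover have "\<forall>\<^sub>F y in nhds t. flat_exp m y = inverse y ^ m / exp (inverse y)"
    using greater by (auto simp: flat_exp_def intro!: eventually_nhds_in_open[of "{0<..}", THEN eventually_mono])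
  ultimately show ?thesis
    using DERIV_cong_ev[OF refl _ refl, of "flat_exp m" "\<lambda>t. inverse t ^ m / exp (inverse t)" t] by blast
next
  case equal
  \<comment> \<open>With y = 1/h this is the right difference quotient at 0; the division by h
    accounts for the extra power in \<open>Suc m\<close>.\<close>
  have "((\<lambda>y. y ^ Suc m / exp y) \<longlongrightarrow> (0::real)) at_top"
    by (rule tendsto_power_div_exp_0)
  then have *: "((\<lambda>h. inverse h ^ Suc m / exp (inverse h)) \<longlongrightarrow> (0::real)) (at_right 0)"
    by (rule filterlim_compose[OF _ filterlim_inverse_at_top_right])
  have "((\<lambda>h. (flat_exp m (0 + h) - flat_exp m 0) / h) \<longlongrightarrow> 0) (at_right 0)"
  proof (rule tendsto_cong[THEN iffD1, OF _ *])
    show "\<forall>\<^sub>F h in at_right 0. inverse h ^ Suc m / exp (inverse h) = (flat_exp m (0 + h) - flat_exp m 0) / h"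
      by (rule eventually_mono[OF eventually_at_right_less]) (auto simp: flat_exp_def field_simps)
  qed
  moreover have "((\<lambda>h. (flat_exp m (0 + h) - flat_exp m 0) / h) \<longlongrightarrow> 0) (at_left 0)"
  proof (rule tendsto_cong[THEN iffD1, OF _ tendsto_const])
    show "\<forall>\<^sub>F h in at_left 0. 0 = (flat_exp m (0 + h) - flat_exp m 0) / h"
      unfolding eventually_at_filter by (rule always_eventually) (auto simp: flat_exp_def)
  qed
  ultimately have "((\<lambda>h. (flat_exp m (0 + h) - flat_exp m 0) / h) \<longlongrightarrow> 0) (at 0)"
    by (rule filterlim_split_at_real[OF _ _, rotated])
  then have "(flat_exp m has_real_derivative 0) (at 0)"
    by (simp add: DERIV_def)
  then show ?thesis using equal by (simp add: flat_exp_def)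
qed

text \<open>Closed under partial derivatives, hence consisting of smooth functions.\<close>

inductive flat_algebra :: "('a::euclidean_space \<Rightarrow> real) \<Rightarrow> bool" where
  const: "flat_algebra (\<lambda>x. c)"
| flat: "flat_algebra (\<lambda>x. flat_exp m (v \<bullet> x + d))"
| add: "flat_algebra f \<Longrightarrow> flat_algebra g \<Longrightarrow> flat_algebra (\<lambda>x. f x + g x)"
| mult: "flat_algebra f \<Longrightarrow> flat_algebra g \<Longrightarrow> flat_algebra (\<lambda>x. f x * g x)"

text \<open>The second conjunct feeds the induction over \<open>k\<close> in \<open>Ck\<close>:
  every directional derivative is again in the algebra. Differences are expressed through constant
  factors such as \<open>- real m\<close>, since the algebra has only sums and products.\<close>

lemma flat_algebra_has_derivative:
  assumes "flat_algebra f"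
  shows "\<exists>D. (\<forall>x. (f has_derivative D x) (at x)) \<and> (\<forall>i. flat_algebra (\<lambda>x. D x i))"
  using assms
proof induction
  case (const c)
  show ?case by (rule exI[of _ "\<lambda>x h. 0"]) (auto intro: flat_algebra.const)
next
  case (flat m v d)
  let ?D = "\<lambda>x h. (v \<bullet> h) * (flat_exp (m + 2) (v \<bullet> x + d) + (- real m) * flat_exp (m + 1) (v \<bullet> x + d))"
  have "((\<lambda>x. flat_exp m (v \<bullet> x + d)) has_derivative ?D x) (at x)" for x
  proof -
    have "((\<lambda>x. v \<bullet> x + d) has_derivative (\<lambda>h. v \<bullet> h)) (at x)"
      by (auto intro!: derivative_eq_intros)
    from has_derivative_compose[OF this flat_exp_has_derivative[of m, unfolded has_field_derivative_def]]
    show ?thesis by (simp add: mult.commute)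
  qed
  moreover have "flat_algebra (\<lambda>x. ?D x i)" for i
    by (intro flat_algebra.intros)
  ultimately show ?case by (intro exI[of _ ?D]) blast
next
  case (add f g)
  then obtain D E where "\<forall>x. (f has_derivative D x) (at x)" "\<forall>i. flat_algebra (\<lambda>x. D x i)"
    "\<forall>x. (g has_derivative E x) (at x)" "\<forall>i. flat_algebra (\<lambda>x. E x i)" by blast
  then show ?case
    by (intro exI[of _ "\<lambda>x h. D x h + E x h"]) (auto intro!: derivative_eq_intros flat_algebra.add)
next
  case (mult f g)
  then obtain D E where "\<forall>x. (f has_derivative D x) (at x)" "\<forall>i. flat_algebra (\<lambda>x. D x i)"
    "\<forall>x. (g has_derivative E x) (at x)" "\<forall>i. flat_algebra (\<lambda>x. E x i)" by blast
  then show ?case using mult.hyps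
    by (intro exI[of _ "\<lambda>x h. f x * E x h + D x h * g x"])
       (auto intro!: derivative_eq_intros flat_algebra.add flat_algebra.mult)
qed

lemma flat_algebra_Ck: "flat_algebra f \<Longrightarrow> Ck k f UNIV"
proof (induction k arbitrary: f)
  case 0
  then show ?case
    using flat_algebra_has_derivative[OF 0]
    by (auto simp: continuous_on_eq_continuous_within intro: has_derivative_continuous)
next
  case (Suc k)
  obtain D where D: "\<And>x. (f has_derivative D x) (at x)" "\<And>i. flat_algebra (\<lambda>x. D x i)"
    using flat_algebra_has_derivative[OF Suc.prems] by blast
  have "frechet_derivative f (at x) = D x" for x
    using frechet_derivative_at[OF D(1)[of x]] by simp
  moreover have "f differentiable_on UNIV"
    using D(1) by (auto simp: differentiable_on_def differentiable_def)
  ultimately show ?case using Suc.IH[OF D(2)] by simp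
qed

lemma flat_algebra_prod:
  assumes "finite A" "\<And>i. i \<in> A \<Longrightarrow> flat_algebra (f i)"
  shows "flat_algebra (\<lambda>x. \<Prod>i\<in>A. f i x)"
  using assms by (induction A rule: finite_induct) (auto intro: flat_algebra.intros)

text \<open>Smooth approximation of the indicator of an open box: a factor exp(-1/((n+1) t))
  increases to 1 for t > 0 and is 0 for t \<le> 0. Growing \<open>n\<close> sharpens the profile
  without moving the support.\<close>

definition box_bump :: "nat \<Rightarrow> 'a::euclidean_space \<Rightarrow> 'a \<Rightarrow> 'a \<Rightarrow> real" where
  "box_bump n a b x = (\<Prod>i\<in>Basis. flat_exp 0 (real (Suc n) * (x \<bullet> i - a \<bullet> i)) * flat_exp 0 (real (Suc n) * (b \<bullet> i - x \<bullet> i)))"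

lemma flat_algebra_box_bump: "flat_algebra (box_bump n a b)"
proof -
  have "flat_algebra (\<lambda>x. flat_exp 0 (real (Suc n) * (x \<bullet> i - a \<bullet> i)))"
       "flat_algebra (\<lambda>x. flat_exp 0 (real (Suc n) * (b \<bullet> i - x \<bullet> i)))" for i
    using flat_algebra.flat[of 0 "real (Suc n) *\<^sub>R i" "- real (Suc n) * (a \<bullet> i)"]
      flat_algebra.flat[of 0 "- (real (Suc n) *\<^sub>R i)" "real (Suc n) * (b \<bullet> i)"]
    by (simp_all add: algebra_simps inner_commute)
  then show ?thesis
    unfolding box_bump_def[abs_def] by (intro flat_algebra_prod flat_algebra.mult) auto
qed

lemma flat_exp_0_nonneg: "0 \<le> flat_exp 0 t" and flat_exp_0_le_1: "flat_exp 0 t \<le> 1"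
  by (auto simp: flat_exp_def)

lemma box_bump_nonneg: "0 \<le> box_bump n a b x"
  unfolding box_bump_def by (intro prod_nonneg) (auto simp: flat_exp_0_nonneg)

lemma box_bump_le_1: "box_bump n a b x \<le> 1"
  unfolding box_bump_def
  by (intro prod_le_1) (auto simp: flat_exp_0_nonneg flat_exp_0_le_1 intro!: mult_le_one)

lemma box_bump_eq_0: "x \<notin> box a b \<Longrightarrow> box_bump n a b x = 0"
proof -
  assume "x \<notin> box a b"
  then obtain i where i: "i \<in> Basis" "x \<bullet> i - a \<bullet> i \<le> 0 \<or> b \<bullet> i - x \<bullet> i \<le> 0"
    by (auto simp: mem_box not_less)
  then have "real (Suc n) * (x \<bullet> i - a \<bullet> i) \<le> 0 \<or> real (Suc n) * (b \<bullet> i - x \<bullet> i) \<le> 0"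
    by (meson mult_nonneg_nonpos of_nat_0_le_iff)
  then show ?thesis
    unfolding box_bump_def using i(1) by (intro prod_zero bexI[of _ i]) (auto simp: flat_exp_def)
qed

lemma box_bump_tendsto: "(\<lambda>n. box_bump n a b x) \<longlonglongrightarrow> indicator (box a b) x"
proof (cases "x \<in> box a b")
  case True
  have *: "(\<lambda>n. flat_exp 0 (real (Suc n) * t)) \<longlonglongrightarrow> 1" if "t > 0" for t
  proof -
    have "(\<lambda>n. exp (- (inverse (real (Suc n)) * inverse t))) \<longlonglongrightarrow> exp (- (0 * inverse t))"
      by (intro tendsto_intros LIMSEQ_inverse_real_of_nat)
    moreover have "flat_exp 0 (real (Suc n) * t) = exp (- (inverse (real (Suc n)) * inverse t))" for n
    proof -
      have "real (Suc n) * t > 0" using that by simp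
      then show ?thesis by (simp add: flat_exp_def exp_minus inverse_eq_divide del: of_nat_Suc)
    qed
    ultimately show ?thesis by simp
  qed
  have "(\<lambda>n. box_bump n a b x) \<longlonglongrightarrow> (\<Prod>i\<in>(Basis::'a set). 1 * 1)"
    unfolding box_bump_def using True by (intro tendsto_prod tendsto_mult *) (auto simp: mem_box)
  then show ?thesis using True by simp
qed (simp add: box_bump_eq_0)

text \<open>The two factors have different tasks. The box from \<open>a\<close> to \<open>b\<close>
  is arbitrary and may leave \<Omega>; the factor for \<open>c\<close> and \<open>d\<close> confines
  the support to a compact subset of \<Omega>.\<close>

lemma test_fun_mult_box_bump:
  assumes "cbox c d \<subseteq> \<Omega>"
  shows "test_fun \<Omega> (\<lambda>x. box_bump n a b x * box_bump n c d x)"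
proof -
  have "closure {x. box_bump n a b x * box_bump n c d x \<noteq> 0} \<subseteq> cbox c d"
    by (rule closure_minimal) (use box_bump_eq_0 box_subset_cbox in \<open>fastforce+\<close>)
  moreover from this have "compact (closure {x. box_bump n a b x * box_bump n c d x \<noteq> 0})"
    by (metis bounded_cbox bounded_subset compact_closure closure_subset)
  moreover have "smooth_fun (\<lambda>x. box_bump n a b x * box_bump n c d x)"
    unfolding smooth_fun_def by (intro allI flat_algebra_Ck flat_algebra.mult flat_algebra_box_bump)
  ultimately show ?thesis unfolding test_fun_def using assms by blast
qed

section \<open>The fundamental lemma of the calculus of variations\<close>

text \<open>Boxes form an intersection-stable generator of the Borel sets, so vanishing integrals
  propagate to all Borel sets. The whole space is not a box; the hypothesis \<open>total\<close>
  serves the complement step.\<close>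

lemma AE_eq_0_if_box_integrals_0:
  fixes h :: "'a::euclidean_space \<Rightarrow> real"
  assumes h: "integrable lborel h" and total: "integral\<^sup>L lborel h = 0"
    and box: "\<And>a b. (\<integral>x. indicator (box a b) x * h x \<partial>lborel) = 0"
  shows "AE x in lborel. h x = 0"
proof -
  let ?E = "range (\<lambda>(a, b). box a b :: 'a set)"
  have int: "set_integrable lborel A h" if "A \<in> sets borel" for A
    using that h unfolding set_integrable_def by (intro integrable_mult_indicator) auto
  have sets: "sigma_sets UNIV ?E = sets borel"
    by (simp add: borel_eq_box)
  have zero: "(LINT x:A|lborel. h x) = 0" if "A \<in> sigma_sets UNIV ?E" for A
  proof (induction rule: sigma_sets_induct_disjoint[OF _ _ that])
    show "Int_stable ?E" by (auto simp: Int_stable_def box_Int_box)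
  next
    fix A assume A: "A \<in> sigma_sets UNIV ?E" and IH: "(LINT x:A|lborel. h x) = 0"
    have "(LINT x:UNIV - A|lborel. h x) = (LINT x|lborel. h x - indicator A x *\<^sub>R h x)"
      unfolding set_lebesgue_integral_def by (intro Bochner_Integration.integral_cong) (auto split: split_indicator)
    also have "\<dots> = 0"
      using total IH h int[of A] A sets unfolding set_lebesgue_integral_def set_integrable_def
      by (subst Bochner_Integration.integral_diff) auto
    finally show "(LINT x:UNIV - A|lborel. h x) = 0" .
  next
    fix A :: "nat \<Rightarrow> 'a set" assume A: "disjoint_family A" "range A \<subseteq> sigma_sets UNIV ?E"
      "\<And>i. (LINT x:A i|lborel. h x) = 0"
    then show "(LINT x:(\<Union>i. A i)|lborel. h x) = 0"
      using sets by (subst lebesgue_integral_countable_add) (auto simp: disjoint_family_on_def intro!: int)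
  qed (auto simp: set_lebesgue_integral_def box)
  then show ?thesis
    using h sets by (intro density_unique_real) auto
qed

text \<open>Dominated convergence replaces smooth bumps by indicators of boxes. This gives the claim
  locally, on boxes with closure in \<Omega>, and a countable cover by such boxes globalises
  it.\<close>

lemma fundamental_lemma_calculus_of_variations:
  fixes g :: "'a::euclidean_space \<Rightarrow> real"
  assumes \<Omega>: "open \<Omega>" and g: "integrable (lebesgue_on \<Omega>) g"
    and test: "\<And>\<phi>. test_fun \<Omega> \<phi> \<Longrightarrow> (\<integral>x. g x * \<phi> x \<partial>lebesgue_on \<Omega>) = 0"
  shows "AE x in lebesgue_on \<Omega>. g x = 0"
proof -
  have \<Omega>_sets: "\<Omega> \<inter> space lebesgue \<in> sets lebesgue"
    using \<Omega> by auto
  define H where "H x = indicator \<Omega> x *\<^sub>R g x" for x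
  have H: "integrable lebesgue H"
    using g integrable_restrict_space[OF \<Omega>_sets, of g] by (simp add: H_def[abs_def])
  have local: "AE x in lborel. x \<in> box c d \<longrightarrow> H x = 0" if cd: "cbox c d \<subseteq> \<Omega>" for c d
  proof -
    \<comment> \<open>Cutting off to the box makes the integral of \<open>h\<close> over any other
      box a limit of integrals against admissible test functions.\<close>
    define h where "h x = indicator (box c d) x * H x" for x
    have h: "integrable lebesgue h"
      using integrable_mult_indicator[OF _ H, of "box c d"] by (simp add: h_def[abs_def])
    have bump_meas: "box_bump n a b \<in> borel_measurable lebesgue" for n and a b :: 'a
      using flat_algebra_Ck[OF flat_algebra_box_bump, of 0 n a b]
      by (simp add: borel_measurable_continuous_onI measurable_completion)
    have H_box: "(\<integral>x. indicator (box a b) x * h x \<partial>lebesgue) = 0" for a b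
    proof -
      have "(\<lambda>n. \<integral>x. H x * (box_bump n a b x * box_bump n c d x) \<partial>lebesgue) \<longlonglongrightarrow>
          (\<integral>x. H x * (indicator (box a b) x * indicator (box c d) x) \<partial>lebesgue)"
      proof (rule integral_dominated_convergence)
        show "integrable lebesgue (\<lambda>x. norm (H x))" using H by simp
        show "AE x in lebesgue. (\<lambda>n. H x * (box_bump n a b x * box_bump n c d x)) \<longlonglongrightarrow>
            H x * (indicator (box a b) x * indicator (box c d) x)"
          by (intro always_eventually allI tendsto_intros box_bump_tendsto)
        show "AE x in lebesgue. norm (H x * (box_bump n a b x * box_bump n c d x)) \<le> norm (H x)" for n
          by (intro always_eventually allI)
             (auto simp: abs_mult box_bump_nonneg box_bump_le_1 intro!: mult_left_le mult_le_one)
      qed (use H bump_meas in \<open>auto intro!: borel_measurable_times borel_measurable_indicator\<close>)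
      moreover have "(\<integral>x. H x * (box_bump n a b x * box_bump n c d x) \<partial>lebesgue) = 0" for n
        using test[OF test_fun_mult_box_bump[OF cd, of n a b]]
          integral_restrict_space[OF \<Omega>_sets, of "\<lambda>x. g x * (box_bump n a b x * box_bump n c d x)"]
        by (simp add: H_def mult.assoc)
      ultimately show ?thesis
        by (simp add: h_def LIMSEQ_const_iff mult_ac)
    qed
    \<comment> \<open>The generator argument lives on \<open>lborel\<close>, while \<open>h\<close>
      is only Lebesgue measurable; a Borel representative is used instead.\<close>
    obtain h' where h': "h' \<in> borel_measurable lborel" "AE x in lborel. h x = h' x"
      using completion_ex_borel_measurable_real[of h lborel] h by auto
    have ae: "AE x in lebesgue. h x = h' x" using h'(2) by (rule AE_completion)
    have h'_meas: "h' \<in> borel_measurable lebesgue" using h'(1) by (rule measurable_completion)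
    have h'_int: "integrable lborel h'"
      using integrable_cong_AE[OF _ h'_meas ae] h integrable_completion[OF h'(1)] by auto
    have set_eq: "(\<integral>x. indicator A x * h' x \<partial>lborel) = (\<integral>x. indicator A x * h x \<partial>lebesgue)"
      if A: "A \<in> sets borel" for A
    proof -
      have [measurable]: "h' \<in> borel_measurable borel" "h \<in> borel_measurable lebesgue" "A \<in> sets borel"
        using h'(1) h A by auto
      have iA: "indicat_real A \<in> borel_measurable lebesgue"
        using A by (auto intro!: borel_measurable_indicator)
      have "(\<integral>x. indicator A x * h' x \<partial>lborel) = (\<integral>x. indicator A x * h' x \<partial>lebesgue)"
        by (rule integral_completion[symmetric]) measurable
      also have "\<dots> = (\<integral>x. indicator A x * h x \<partial>lebesgue)"
        using ae h'_meas iA h by (intro integral_cong_AE) auto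
      finally show ?thesis .
    qed
    have "AE x in lborel. h' x = 0"
    proof (rule AE_eq_0_if_box_integrals_0[OF h'_int])
      have "(\<integral>x. h x \<partial>lebesgue) = (\<integral>x. indicator (box c d) x * h x \<partial>lebesgue)"
        by (intro Bochner_Integration.integral_cong) (auto simp: h_def split: split_indicator)
      then show "integral\<^sup>L lborel h' = 0"
        using set_eq[of UNIV] H_box[of c d] by simp
    qed (simp add: set_eq H_box)
    with h'(2) show ?thesis
      by eventually_elim (auto simp: h_def indicator_def split: if_splits)
  qed
  obtain \<D> where \<D>: "countable \<D>" "\<D> \<subseteq> Pow \<Omega>" "\<And>X. X \<in> \<D> \<Longrightarrow> \<exists>a b. X = cbox a b" "\<Union>\<D> = \<Omega>"
    using open_countable_Union_open_cbox[OF \<Omega>] by metis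
  have "AE x in lborel. x \<in> X \<longrightarrow> H x = 0" if "X \<in> \<D>" for X
  proof -
    obtain a b where X: "X = cbox a b" using \<D>(3) \<open>X \<in> \<D>\<close> by blast
    \<comment> \<open>The cover consists of closed boxes, but the local result speaks of open ones;
      the faces between them form a null set.\<close>
    have "AE x in lborel. x \<notin> cbox a b - box a b"
      by (rule AE_not_in[OF null_sets_cbox_Diff_box])
    moreover have "AE x in lborel. x \<in> box a b \<longrightarrow> H x = 0"
      using local X \<D>(2) \<open>X \<in> \<D>\<close> by auto
    ultimately show ?thesis by eventually_elim (auto simp: X)
  qed
  then have "AE x in lborel. \<forall>X\<in>\<D>. x \<in> X \<longrightarrow> H x = 0"
    using \<D>(1) by (subst AE_ball_countable) auto
  then have "AE x in lborel. x \<in> \<Omega> \<longrightarrow> g x = 0"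
    by eventually_elim (use \<D>(4) in \<open>auto simp: H_def indicator_def split: if_splits\<close>)
  then show ?thesis
    using AE_restrict_space_iff[OF \<Omega>_sets] AE_completion by blast
qed

section \<open>Lebesgue norms and Hoelder's inequality\<close>

text \<open>Young's inequality, applied pointwise after dividing by the two norms. The normalisation
  requires both norms to be nonzero; otherwise the product vanishes almost everywhere.\<close>

lemma Hoelder_inequality:
  fixes f g :: "'a \<Rightarrow> real"
  assumes pq: "p > 1" "q > 1" "1 / p + 1 / q = 1"
    and meas[measurable]: "f \<in> borel_measurable M" "g \<in> borel_measurable M"
    and nonneg: "\<And>x. 0 \<le> f x" "\<And>x. 0 \<le> g x"
    and int: "integrable M (\<lambda>x. f x powr p)" "integrable M (\<lambda>x. g x powr q)"
  shows "integrable M (\<lambda>x. f x * g x)"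
    and "(\<integral>x. f x * g x \<partial>M) \<le> (\<integral>x. f x powr p \<partial>M) powr (1 / p) * (\<integral>x. g x powr q \<partial>M) powr (1 / q)"
proof -
  show fg: "integrable M (\<lambda>x. f x * g x)"
  proof (rule Bochner_Integration.integrable_bound)
    show "integrable M (\<lambda>x. f x powr p / p + g x powr q / q)"
      using int by auto
    show "AE x in M. norm (f x * g x) \<le> norm (f x powr p / p + g x powr q / q)"
    proof (intro always_eventually allI)
      fix x
      show "norm (f x * g x) \<le> norm (f x powr p / p + g x powr q / q)"
        using Youngs_inequality[OF pq nonneg, of x x] nonneg[of x] by (simp add: abs_mult)
    qed
  qed simp
  define A where "A = (\<integral>x. f x powr p \<partial>M)"
  define B where "B = (\<integral>x. g x powr q \<partial>M)"
  have "A \<ge> 0" "B \<ge> 0" by (auto simp: A_def B_def)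
  show "(\<integral>x. f x * g x \<partial>M) \<le> (\<integral>x. f x powr p \<partial>M) powr (1 / p) * (\<integral>x. g x powr q \<partial>M) powr (1 / q)"
  proof (cases "A = 0 \<or> B = 0")
    case True
    have "AE x in M. f x * g x = 0"
    proof (cases "A = 0")
      case True
      then have "AE x in M. f x powr p = 0"
        unfolding A_def using int(1) by (subst (asm) integral_nonneg_eq_0_iff_AE) auto
      then show ?thesis by eventually_elim auto
    next
      case False
      with True have "B = 0" by simp
      then have "AE x in M. g x powr q = 0"
        unfolding B_def using int(2) by (subst (asm) integral_nonneg_eq_0_iff_AE) auto
      then show ?thesis by eventually_elim auto
    qed
    then have "(\<integral>x. f x * g x \<partial>M) = 0" by (rule integral_eq_zero_AE)
    then show ?thesis by simp
  next
    case False
    define a where "a = A powr (1 / p)"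
    define b where "b = B powr (1 / q)"
    have ab: "a > 0" "b > 0" "a powr p = A" "b powr q = B" "A > 0" "B > 0"
      using False \<open>A \<ge> 0\<close> \<open>B \<ge> 0\<close> pq by (auto simp: a_def b_def powr_powr)
    have "(\<integral>x. f x * g x \<partial>M) / (a * b) = (\<integral>x. f x / a * (g x / b) \<partial>M)"
      by (subst integral_divide_zero[symmetric], rule Bochner_Integration.integral_cong) auto
    also have "\<dots> \<le> (\<integral>x. f x powr p / (p * A) + g x powr q / (q * B) \<partial>M)"
    proof (rule integral_mono)
      show "integrable M (\<lambda>x. f x / a * (g x / b))" using fg by (simp add: times_divide_times_eq)
      show "integrable M (\<lambda>x. f x powr p / (p * A) + g x powr q / (q * B))" using int by simp
      fix x
      have "f x / a * (g x / b) \<le> (f x / a) powr p / p + (g x / b) powr q / q"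
        using nonneg ab by (intro Youngs_inequality pq) auto
      then show "f x / a * (g x / b) \<le> f x powr p / (p * A) + g x powr q / (q * B)"
        using nonneg ab by (simp add: powr_divide mult.commute)
    qed
    also have "\<dots> = A / (p * A) + B / (q * B)"
      using int by (simp add: A_def B_def)
    also have "\<dots> = 1" using ab pq by simp
    finally show ?thesis using ab by (simp add: divide_le_eq A_def B_def a_def b_def)
  qed
qed

lemma Lnorm_nonneg: "0 \<le> Lnorm \<Omega> p f"
  by (simp add: Lnorm_def)

lemma Lnorm_powr:
  assumes "p > 0"
  shows "Lnorm \<Omega> p f powr p = (\<integral>x. norm (f x) powr p \<partial>lebesgue_on \<Omega>)"
  using assms by (simp add: Lnorm_def powr_powr)

lemma Lp_zero: "Lp \<Omega> p (\<lambda>x. 0)"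
  by (simp add: Lp_def)

lemma Lnorm_zero: "Lnorm \<Omega> p (\<lambda>x. 0) = 0"
  by (simp add: Lnorm_def)

lemma Lp_scaleR: "Lp \<Omega> p f \<Longrightarrow> Lp \<Omega> p (\<lambda>x. a *\<^sub>R f x)"
  by (auto simp: Lp_def powr_mult)

lemma Lnorm_scaleR:
  assumes "p > 0"
  shows "Lnorm \<Omega> p (\<lambda>x. a *\<^sub>R f x) = \<bar>a\<bar> * Lnorm \<Omega> p f"
  using assms by (simp add: Lnorm_def powr_mult powr_powr)

lemma Lnorm_cong_AE:
  assumes "f \<in> borel_measurable (lebesgue_on \<Omega>)" "g \<in> borel_measurable (lebesgue_on \<Omega>)"
    and "AE x in lebesgue_on \<Omega>. norm (f x) = norm (g x)"
  shows "Lnorm \<Omega> p f = Lnorm \<Omega> p g"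
proof -
  have "(\<integral>x. norm (f x) powr p \<partial>lebesgue_on \<Omega>) = (\<integral>x. norm (g x) powr p \<partial>lebesgue_on \<Omega>)"
    using assms by (intro integral_cong_AE) auto
  then show ?thesis by (simp add: Lnorm_def)
qed

lemma Lp_Hoelder:
  assumes pq: "p > 1" "q > 1" "1 / p + 1 / q = 1" and f: "Lp \<Omega> p f" and g: "Lp \<Omega> q g"
  shows "integrable (lebesgue_on \<Omega>) (\<lambda>x. norm (f x) * norm (g x))"
    and "(\<integral>x. norm (f x) * norm (g x) \<partial>lebesgue_on \<Omega>) \<le> Lnorm \<Omega> p f * Lnorm \<Omega> q g"
  using Hoelder_inequality[OF pq, of "\<lambda>x. norm (f x)" "lebesgue_on \<Omega>" "\<lambda>x. norm (g x)"] f g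
  by (auto simp: Lp_def Lnorm_def)

text \<open>Hoelder's inequality for |f|^r against the constant 1, with the conjugate exponents s/r
  and s/(s-r).\<close>

lemma Lp_inclusion:
  assumes \<Omega>: "\<Omega> \<in> lmeasurable" and r: "1 \<le> r" "r < s" and f: "Lp \<Omega> s f"
  shows "Lp \<Omega> r f"
    and "Lnorm \<Omega> r f \<le> measure lebesgue \<Omega> powr (1 / r - 1 / s) * Lnorm \<Omega> s f"
proof -
  interpret finite_measure "lebesgue_on \<Omega>"
    using \<Omega> by (rule finite_measure_lebesgue_on)
  have [measurable]: "f \<in> borel_measurable (lebesgue_on \<Omega>)" using f by (simp add: Lp_def)
  have exps: "s / r > 1" "s / (s - r) > 1" "1 / (s / r) + 1 / (s / (s - r)) = 1"
    using r by (auto simp: field_simps)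
  have int_s: "integrable (lebesgue_on \<Omega>) (\<lambda>x. (norm (f x) powr r) powr (s / r))"
    using f r by (simp add: Lp_def powr_powr)
  note H = Hoelder_inequality[OF exps, of "\<lambda>x. norm (f x) powr r" "lebesgue_on \<Omega>" "\<lambda>x. 1"]
  show "Lp \<Omega> r f"
    using H(1) int_s by (simp add: Lp_def)
  have "(\<integral>x. norm (f x) powr r \<partial>lebesgue_on \<Omega>)
      \<le> (\<integral>x. norm (f x) powr s \<partial>lebesgue_on \<Omega>) powr (r / s) * measure lebesgue \<Omega> powr ((s - r) / s)"
    using H(2) int_s r \<Omega> by (simp add: powr_powr measure_restrict_space)
  then have "(\<integral>x. norm (f x) powr r \<partial>lebesgue_on \<Omega>) powr (1 / r)
      \<le> ((\<integral>x. norm (f x) powr s \<partial>lebesgue_on \<Omega>) powr (r / s) * measure lebesgue \<Omega> powr ((s - r) / s)) powr (1 / r)"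
    using r by (intro powr_mono2) auto
  also have "\<dots> = measure lebesgue \<Omega> powr ((s - r) / s * (1 / r)) * Lnorm \<Omega> s f"
    using r by (simp add: powr_mult powr_powr Lnorm_def)
  also have "(s - r) / s * (1 / r) = 1 / r - 1 / s" using r by (simp add: field_simps)
  finally show "Lnorm \<Omega> r f \<le> measure lebesgue \<Omega> powr (1 / r - 1 / s) * Lnorm \<Omega> s f"
    by (simp add: Lnorm_def)
qed

lemma conj_exp_props:
  assumes "s > 1"
  shows "conj_exp s > 1" "1 / conj_exp s + 1 / s = 1" "1 / s + 1 / conj_exp s = 1" "conj_exp s - 1 = 1 / (s - 1)"
    "(conj_exp s - 1) * s = conj_exp s" "(s - 1) * conj_exp s = s" "conj_exp (conj_exp s) = s"
  using assms by (auto simp: conj_exp_def field_simps)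

section \<open>Extremal functions for Hoelder's inequality\<close>

text \<open>This is |t|^(p-2) t, the derivative of |t|^p / p. Writing it with \<open>sgn\<close>
  keeps the exponent p-1 positive for every p > 1, in particular for p = r < 2.\<close>

definition duality_map :: "real \<Rightarrow> real \<Rightarrow> real" where
  "duality_map p t = sgn t * \<bar>t\<bar> powr (p - 1)"

lemma abs_duality_map: "\<bar>duality_map p t\<bar> = \<bar>t\<bar> powr (p - 1)"
  by (simp add: duality_map_def abs_mult abs_sgn_eq)

lemma mult_duality_map: "t * duality_map p t = \<bar>t\<bar> powr p"
proof (cases "t = 0")
  case False
  have "t * duality_map p t = \<bar>t\<bar> * \<bar>t\<bar> powr (p - 1)"
    by (simp add: duality_map_def abs_sgn mult.assoc)
  also have "\<dots> = \<bar>t\<bar> powr p"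
    using False powr_mult_base[of "\<bar>t\<bar>" "p - 1"] by simp
  finally show ?thesis .
qed (simp add: duality_map_def)

lemma borel_measurable_duality_map [measurable]: "duality_map p \<in> borel_measurable borel"
  unfolding duality_map_def[abs_def] by measurable

text \<open>Used twice: with p = s to build the test function for the divergence, and with p = r,
  whose conjugate exponent is \<open>s\<close>, to build the one for the pressure.\<close>

lemma Lp_duality_map:
  assumes p: "p > 1" and f: "Lp \<Omega> p f"
  shows "Lp \<Omega> (conj_exp p) (\<lambda>x. duality_map p (f x))"
    and "Lnorm \<Omega> (conj_exp p) (\<lambda>x. duality_map p (f x)) = Lnorm \<Omega> p f powr (p - 1)"
    and "(\<integral>x. f x * duality_map p (f x) \<partial>lebesgue_on \<Omega>) = Lnorm \<Omega> p f powr p"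
proof -
  have *: "\<bar>duality_map p t\<bar> powr conj_exp p = \<bar>t\<bar> powr p" for t
    using p by (simp add: abs_duality_map powr_powr conj_exp_props)
  show "Lp \<Omega> (conj_exp p) (\<lambda>x. duality_map p (f x))"
    using f by (auto simp: Lp_def * intro: measurable_compose[OF _ borel_measurable_duality_map])
  have "(p - 1) / p = 1 / conj_exp p" using p by (simp add: conj_exp_def)
  then show "Lnorm \<Omega> (conj_exp p) (\<lambda>x. duality_map p (f x)) = Lnorm \<Omega> p f powr (p - 1)"
    using p by (simp add: Lnorm_def * powr_powr)
  show "(\<integral>x. f x * duality_map p (f x) \<partial>lebesgue_on \<Omega>) = Lnorm \<Omega> p f powr p"
    using p by (simp add: Lnorm_powr mult_duality_map)
qed

section \<open>A right inverse of the divergence\<close>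

lemma integrable_lborel_translation:
  fixes f :: "'a::euclidean_space \<Rightarrow> real"
  assumes "f \<in> borel_measurable borel"
  shows "integrable lborel (\<lambda>x. f (c + x)) \<longleftrightarrow> integrable lborel f"
  using integrable_distr_eq[of "(+) c" lborel borel f] assms by (simp add: lborel_distr_plus)

lemma integral_lborel_translation:
  fixes f :: "'a::euclidean_space \<Rightarrow> real"
  assumes "f \<in> borel_measurable borel"
  shows "(\<integral>x. f (c + x) \<partial>lborel) = (\<integral>x. f x \<partial>lborel)"
  using integral_distr[of "(+) c" lborel borel f] assms by (simp add: lborel_distr_plus)

lemma nn_integral_lborel_translation:
  fixes f :: "'a::euclidean_space \<Rightarrow> ennreal"
  assumes "f \<in> borel_measurable borel"
  shows "(\<integral>\<^sup>+x. f (c + x) \<partial>lborel) = (\<integral>\<^sup>+x. f x \<partial>lborel)"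
  using nn_integral_distr[of "(+) c" lborel borel f] assms by (simp add: lborel_distr_plus)

text \<open>
  Integrating over translates of \<open>w\<close>, instead of slicing along a coordinate, makes Fubini's theorem and
  translation invariance of \<open>lborel\<close> sufficient.  For \<open>w\<close> supported in \<open>\<Omega>\<close> and \<open>L\<close> beyond the diameter
  of \<open>\<Omega>\<close>, this is on \<open>\<Omega>\<close> the antiderivative of \<open>w\<close> in direction \<open>e\<close>.
\<close>

definition ray_integral :: "real \<Rightarrow> 'a::euclidean_space \<Rightarrow> ('a \<Rightarrow> real) \<Rightarrow> 'a \<Rightarrow> real" where
  "ray_integral L e w x = (\<integral>t. indicator {0..L} t * w (x - t *\<^sub>R e) \<partial>lborel)"

lemma borel_measurable_ray_integral:
  assumes [measurable]: "w \<in> borel_measurable borel"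
  shows "ray_integral L e w \<in> borel_measurable borel"
  unfolding ray_integral_def[abs_def] by measurable

text \<open>Hoelder's inequality on [0, L] against the constant 1; the power of \<open>L\<close> is
  s divided by the conjugate exponent, that is s-1. Extended nonnegative integrals allow slices on
  which the right-hand side is infinite.\<close>

lemma ray_integral_powr_le:
  fixes w :: "'a::euclidean_space \<Rightarrow> real"
  assumes s: "s > 1" and L: "L > 0" and w[measurable]: "w \<in> borel_measurable borel"
  shows "ennreal (\<bar>ray_integral L e w x\<bar> powr s)
    \<le> ennreal (L powr (s - 1)) * (\<integral>\<^sup>+t. indicator {0..L} t * ennreal (\<bar>w (x - t *\<^sub>R e)\<bar> powr s) \<partial>lborel)"
proof (cases "(\<integral>\<^sup>+t. indicator {0..L} t * ennreal (\<bar>w (x - t *\<^sub>R e)\<bar> powr s) \<partial>lborel) = \<infinity>")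
  case True
  then show ?thesis using L by (simp add: ennreal_mult_eq_top_iff)
next
  case False
  define f where "f t = indicator {0..L} t * \<bar>w (x - t *\<^sub>R e)\<bar>" for t
  define I :: "real \<Rightarrow> real" where "I = indicator {0..L}"
  have [measurable]: "f \<in> borel_measurable borel" "I \<in> borel_measurable borel"
    unfolding f_def[abs_def] I_def by measurable
  have fs: "ennreal (f t powr s) = indicator {0..L} t * ennreal (\<bar>w (x - t *\<^sub>R e)\<bar> powr s)" for t
    by (simp add: f_def split: split_indicator)
  have f_int: "integrable lborel (\<lambda>t. f t powr s)"
  proof (rule integrableI_bounded)
    show "(\<integral>\<^sup>+t. ennreal (norm (f t powr s)) \<partial>lborel) < \<infinity>"
      using False by (simp add: fs less_top)
  qed simp
  have I_powr: "I t powr q = I t" for t q by (simp add: I_def split: split_indicator)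
  have I_int: "integrable lborel I" "(\<integral>t. I t \<partial>lborel) = L"
    using L by (auto simp: I_def)
  have f_nonneg: "0 \<le> f t" "0 \<le> I t" for t by (auto simp: f_def I_def)
  have exps: "s > 1" "conj_exp s > 1" "1 / s + 1 / conj_exp s = 1"
    using s conj_exp_props[of s] by auto
  have "(\<integral>t. f t * I t \<partial>lborel) \<le> (\<integral>t. f t powr s \<partial>lborel) powr (1 / s) * L powr (1 / conj_exp s)"
    using Hoelder_inequality(2)[OF exps, of f lborel I] f_int f_nonneg I_int I_powr by simp
  moreover have "\<bar>ray_integral L e w x\<bar> \<le> (\<integral>t. f t * I t \<partial>lborel)"
  proof -
    have "\<bar>ray_integral L e w x\<bar> \<le> (\<integral>t. norm (indicator {0..L} t * w (x - t *\<^sub>R e)) \<partial>lborel)"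
      unfolding ray_integral_def real_norm_def[symmetric] by (rule integral_norm_bound)
    also have "\<dots> = (\<integral>t. f t * I t \<partial>lborel)"
      by (intro Bochner_Integration.integral_cong) (auto simp: f_def I_def split: split_indicator)
    finally show ?thesis .
  qed
  ultimately have "\<bar>ray_integral L e w x\<bar> powr s
      \<le> ((\<integral>t. f t powr s \<partial>lborel) powr (1 / s) * L powr (1 / conj_exp s)) powr s"
    using s by (intro powr_mono2) auto
  also have "\<dots> = L powr (s / conj_exp s) * (\<integral>t. f t powr s \<partial>lborel)"
    using s L by (simp add: powr_mult powr_powr)
  also have "s / conj_exp s = s - 1" using s by (simp add: conj_exp_def)
  finally have "ennreal (\<bar>ray_integral L e w x\<bar> powr s) \<le> ennreal (L powr (s - 1)) * ennreal (\<integral>t. f t powr s \<partial>lborel)"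
    by (simp flip: ennreal_mult)
  also have "ennreal (\<integral>t. f t powr s \<partial>lborel) = (\<integral>\<^sup>+t. ennreal (f t powr s) \<partial>lborel)"
    using f_int by (subst nn_integral_eq_integral) auto
  finally show ?thesis by (simp add: fs)
qed

text \<open>Integrate the pointwise bound and exchange the integrals. By translation invariance the
  inner integral no longer depends on \<open>t\<close>, so integrating over [0, L] adds one more
  factor \<open>L\<close>.\<close>

lemma ray_integral_Lp:
  fixes w :: "'a::euclidean_space \<Rightarrow> real"
  assumes s: "s > 1" and L: "L > 0" and w[measurable]: "w \<in> borel_measurable borel"
    and w_int: "integrable lborel (\<lambda>x. \<bar>w x\<bar> powr s)"
  shows "integrable lborel (\<lambda>x. \<bar>ray_integral L e w x\<bar> powr s)"
    and "(\<integral>x. \<bar>ray_integral L e w x\<bar> powr s \<partial>lborel) \<le> L powr s * (\<integral>x. \<bar>w x\<bar> powr s \<partial>lborel)"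
proof -
  note [measurable] = borel_measurable_ray_integral[OF w]
  have "(\<integral>\<^sup>+x. ennreal (\<bar>ray_integral L e w x\<bar> powr s) \<partial>lborel)
      \<le> (\<integral>\<^sup>+x. ennreal (L powr (s - 1)) *
            (\<integral>\<^sup>+t. indicator {0..L} t * ennreal (\<bar>w (x - t *\<^sub>R e)\<bar> powr s) \<partial>lborel) \<partial>lborel)"
    by (intro nn_integral_mono ray_integral_powr_le s L w)
  also have "\<dots> = ennreal (L powr (s - 1)) *
      (\<integral>\<^sup>+x. (\<integral>\<^sup>+t. indicator {0..L} t * ennreal (\<bar>w (x - t *\<^sub>R e)\<bar> powr s) \<partial>lborel) \<partial>lborel)"
    by (intro nn_integral_cmult) measurable
  also have "(\<integral>\<^sup>+x. (\<integral>\<^sup>+t. indicator {0..L} t * ennreal (\<bar>w (x - t *\<^sub>R e)\<bar> powr s) \<partial>lborel) \<partial>lborel)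
      = (\<integral>\<^sup>+t. (\<integral>\<^sup>+x. indicator {0..L} t * ennreal (\<bar>w (x - t *\<^sub>R e)\<bar> powr s) \<partial>lborel) \<partial>lborel)"
    by (rule lborel_pair.Fubini') measurable
  also have "\<dots> = (\<integral>\<^sup>+t. indicator {0..L} t * (\<integral>\<^sup>+x. ennreal (\<bar>w x\<bar> powr s) \<partial>lborel) \<partial>lborel)"
  proof (rule nn_integral_cong)
    fix t :: real
    have "(\<integral>\<^sup>+x. indicator {0..L} t * ennreal (\<bar>w (x - t *\<^sub>R e)\<bar> powr s) \<partial>lborel)
        = indicator {0..L} t * (\<integral>\<^sup>+x. ennreal (\<bar>w (- (t *\<^sub>R e) + x)\<bar> powr s) \<partial>lborel)"
      by (subst nn_integral_cmult) auto
    also have "(\<integral>\<^sup>+x. ennreal (\<bar>w (- (t *\<^sub>R e) + x)\<bar> powr s) \<partial>lborel) = (\<integral>\<^sup>+x. ennreal (\<bar>w x\<bar> powr s) \<partial>lborel)"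
      by (rule nn_integral_lborel_translation) measurable
    finally show "(\<integral>\<^sup>+x. indicator {0..L} t * ennreal (\<bar>w (x - t *\<^sub>R e)\<bar> powr s) \<partial>lborel)
        = indicator {0..L} t * (\<integral>\<^sup>+x. ennreal (\<bar>w x\<bar> powr s) \<partial>lborel)" .
  qed
  also have "\<dots> = ennreal L * (\<integral>\<^sup>+x. ennreal (\<bar>w x\<bar> powr s) \<partial>lborel)"
    using L by (subst nn_integral_multc) auto
  also have "(\<integral>\<^sup>+x. ennreal (\<bar>w x\<bar> powr s) \<partial>lborel) = ennreal (\<integral>x. \<bar>w x\<bar> powr s \<partial>lborel)"
    by (rule nn_integral_eq_integral[OF w_int]) auto
  also have "ennreal (L powr (s - 1)) * (ennreal L * ennreal (\<integral>x. \<bar>w x\<bar> powr s \<partial>lborel))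
      = ennreal (L powr s * (\<integral>x. \<bar>w x\<bar> powr s \<partial>lborel))"
    using L powr_mult_base[of L "s - 1"] by (simp add: mult_ac flip: ennreal_mult)
  finally have le: "(\<integral>\<^sup>+x. ennreal (\<bar>ray_integral L e w x\<bar> powr s) \<partial>lborel)
      \<le> ennreal (L powr s * (\<integral>x. \<bar>w x\<bar> powr s \<partial>lborel))" .
  show int: "integrable lborel (\<lambda>x. \<bar>ray_integral L e w x\<bar> powr s)"
    by (rule integrableI_bounded) (use le in \<open>auto simp: le_less_trans[OF _ ennreal_less_top]\<close>)
  show "(\<integral>x. \<bar>ray_integral L e w x\<bar> powr s \<partial>lborel) \<le> L powr s * (\<integral>x. \<bar>w x\<bar> powr s \<partial>lborel)"
    using le int by (subst (asm) nn_integral_eq_integral) auto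
qed

text \<open>Fubini and a translation move the shift from \<open>w\<close> to the derivative of
  \<phi>, where the fundamental theorem of calculus evaluates the integral over \<open>t\<close>.
  Hence \<open>w\<close> needs no regularity beyond integrability.\<close>

lemma ray_integral_integral_by_parts:
  fixes w :: "'a::euclidean_space \<Rightarrow> real" and \<phi> :: "'a \<Rightarrow> real"
  assumes L: "L > 0" and w[measurable]: "w \<in> borel_measurable borel" and w_int: "integrable lborel w"
    and D: "\<And>x. (\<phi> has_derivative D x) (at x)" and D_cont: "continuous_on UNIV (\<lambda>x. D x e)"
    and D_bound: "\<And>x. \<bar>D x e\<bar> \<le> C"
  shows "(\<integral>x. ray_integral L e w x * D x e \<partial>lborel) = (\<integral>x. w x * (\<phi> (x + L *\<^sub>R e) - \<phi> x) \<partial>lborel)"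
proof -
  define d where "d x = D x e" for x
  have [measurable]: "d \<in> borel_measurable borel"
    using D_cont unfolding d_def[abs_def] by (rule borel_measurable_continuous_onI)
  have I_int: "integrable lborel (indicat_real {0..L})" using L by auto
  have w_trans: "integrable lborel (\<lambda>x. w (x - t *\<^sub>R e))"
       "(\<integral>x. \<bar>w (x - t *\<^sub>R e)\<bar> \<partial>lborel) = (\<integral>x. \<bar>w x\<bar> \<partial>lborel)" for t
    using integrable_lborel_translation[OF w, of "- (t *\<^sub>R e)"] w_int
      integral_lborel_translation[of "\<lambda>x. \<bar>w x\<bar>" "- (t *\<^sub>R e)"] by (auto)
  have bound: "\<bar>i * a * d x\<bar> \<le> \<bar>C * (i * \<bar>a\<bar>)\<bar>" if "0 \<le> i" for i a x
  proof -
    have "\<bar>i * a\<bar> * \<bar>d x\<bar> \<le> \<bar>i * a\<bar> * \<bar>C\<bar>"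
      using D_bound[of x] by (intro mult_left_mono) (auto simp: d_def)
    then show ?thesis by (simp add: abs_mult mult_ac)
  qed
  \<comment> \<open>Fubini needs joint integrability. The bounded derivative is replaced by
    \<open>C\<close>; the remaining majorant has the same integral over \<open>x\<close> for each
    \<open>t\<close> in [0, L].\<close>
  have int1: "integrable (lborel \<Otimes>\<^sub>M lborel) (\<lambda>(t, x). indicator {0..L} t * w (x - t *\<^sub>R e) * d x)"
  proof (rule Bochner_Integration.integrable_bound)
    have "integrable (lborel \<Otimes>\<^sub>M lborel) (\<lambda>(t, x). indicat_real {0..L} t * \<bar>w (x - t *\<^sub>R e)\<bar>)"
    proof (rule lborel_pair.Fubini_integrable)
      show "integrable lborel (\<lambda>t. \<integral>x. norm (case (t, x) of (t, x) \<Rightarrow> indicat_real {0..L} t * \<bar>w (x - t *\<^sub>R e)\<bar>) \<partial>lborel)"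
        using I_int by (simp add: abs_mult w_trans)
      show "AE t in lborel. integrable lborel (\<lambda>x. case (t, x) of (t, x) \<Rightarrow> indicat_real {0..L} t * \<bar>w (x - t *\<^sub>R e)\<bar>)"
        using w_trans by auto
    qed measurable
    then show "integrable (lborel \<Otimes>\<^sub>M lborel) (\<lambda>p. C * (case p of (t, x) \<Rightarrow> indicat_real {0..L} t * \<bar>w (x - t *\<^sub>R e)\<bar>))"
      by (rule integrable_mult_right)
    show "AE p in lborel \<Otimes>\<^sub>M lborel. norm (case p of (t, x) \<Rightarrow> indicator {0..L} t * w (x - t *\<^sub>R e) * d x)
        \<le> norm (C * (case p of (t, x) \<Rightarrow> indicat_real {0..L} t * \<bar>w (x - t *\<^sub>R e)\<bar>))"
      by (intro always_eventually allI) (auto split: prod.split intro!: bound)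
  qed measurable
  have int2: "integrable (lborel \<Otimes>\<^sub>M lborel) (\<lambda>(t, x). indicator {0..L} t * w x * d (x + t *\<^sub>R e))"
  proof (rule Bochner_Integration.integrable_bound)
    have "integrable (lborel \<Otimes>\<^sub>M lborel) (\<lambda>(t, x). indicat_real {0..L} t * \<bar>w x\<bar>)"
    proof (rule lborel_pair.Fubini_integrable)
      show "integrable lborel (\<lambda>t. \<integral>x. norm (case (t, x) of (t, x) \<Rightarrow> indicat_real {0..L} t * \<bar>w x\<bar>) \<partial>lborel)"
        using I_int by (simp add: abs_mult)
      show "AE t in lborel. integrable lborel (\<lambda>x. case (t, x) of (t, x) \<Rightarrow> indicat_real {0..L} t * \<bar>w x\<bar>)"
        using w_int by auto
    qed measurable
    then show "integrable (lborel \<Otimes>\<^sub>M lborel) (\<lambda>p. C * (case p of (t, x) \<Rightarrow> indicat_real {0..L} t * \<bar>w x\<bar>))"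
      by (rule integrable_mult_right)
    show "AE p in lborel \<Otimes>\<^sub>M lborel. norm (case p of (t, x) \<Rightarrow> indicator {0..L} t * w x * d (x + t *\<^sub>R e))
        \<le> norm (C * (case p of (t, x) \<Rightarrow> indicat_real {0..L} t * \<bar>w x\<bar>))"
      by (intro always_eventually allI) (auto split: prod.split intro!: bound)
  qed measurable
  have ftc: "(\<integral>t. indicator {0..L} t * d (x + t *\<^sub>R e) \<partial>lborel) = \<phi> (x + L *\<^sub>R e) - \<phi> x" for x
  proof -
    have "((\<lambda>t. \<phi> (x + t *\<^sub>R e)) has_real_derivative d (x + t *\<^sub>R e)) (at t)" for t
    proof -
      have "((\<lambda>t. x + t *\<^sub>R e) has_derivative (\<lambda>h. h *\<^sub>R e)) (at t)"
        by (auto intro!: derivative_eq_intros)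
      moreover have "D (x + t *\<^sub>R e) (h *\<^sub>R e) = d (x + t *\<^sub>R e) * h" for h
        using linear_cmul[OF has_derivative_linear[OF D], of "x + t *\<^sub>R e" h e] by (simp add: d_def)
      ultimately show ?thesis
        using has_derivative_compose[of "\<lambda>t. x + t *\<^sub>R e" "\<lambda>h. h *\<^sub>R e" t UNIV \<phi> "D (x + t *\<^sub>R e)"] D
        by (simp add: has_field_derivative_def)
    qed
    moreover have "isCont (\<lambda>t. d (x + t *\<^sub>R e)) t" for t
    proof -
      have "continuous_on UNIV (\<lambda>t. d (x + t *\<^sub>R e))"
        unfolding d_def by (rule continuous_on_compose2[OF D_cont]) (auto intro!: continuous_intros)
      then show ?thesis using continuous_on_eq_continuous_at[OF open_UNIV] by blast
    qed
    ultimately have "(\<integral>t. d (x + t *\<^sub>R e) * indicator {0..L} t \<partial>lborel) = \<phi> (x + L *\<^sub>R e) - \<phi> (x + 0 *\<^sub>R e)"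
      using L by (intro integral_FTC_Icc_real) auto
    then show ?thesis by (simp only: mult.commute scaleR_zero_left add_0_right)
  qed
  have "(\<integral>x. ray_integral L e w x * D x e \<partial>lborel)
      = (\<integral>x. (\<integral>t. indicator {0..L} t * w (x - t *\<^sub>R e) * d x \<partial>lborel) \<partial>lborel)"
    by (simp add: ray_integral_def d_def)
  also have "\<dots> = (\<integral>t. (\<integral>x. indicator {0..L} t * w (x - t *\<^sub>R e) * d x \<partial>lborel) \<partial>lborel)"
    by (rule lborel_pair.Fubini_integral[OF int1])
  also have "\<dots> = (\<integral>t. (\<integral>x. indicator {0..L} t * w x * d (x + t *\<^sub>R e) \<partial>lborel) \<partial>lborel)"
  proof (rule Bochner_Integration.integral_cong[OF refl])
    fix t :: real
    show "(\<integral>x. indicator {0..L} t * w (x - t *\<^sub>R e) * d x \<partial>lborel)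
        = (\<integral>x. indicator {0..L} t * w x * d (x + t *\<^sub>R e) \<partial>lborel)"
      using integral_lborel_translation[of "\<lambda>x. indicator {0..L} t * w (x - t *\<^sub>R e) * d x" "t *\<^sub>R e"]
      by (simp add: add.commute)
  qed
  also have "\<dots> = (\<integral>x. (\<integral>t. indicator {0..L} t * w x * d (x + t *\<^sub>R e) \<partial>lborel) \<partial>lborel)"
    by (rule lborel_pair.Fubini_integral[OF int2, symmetric])
  also have "\<dots> = (\<integral>x. w x * (\<integral>t. indicator {0..L} t * d (x + t *\<^sub>R e) \<partial>lborel) \<partial>lborel)"
  proof (rule Bochner_Integration.integral_cong[OF refl])
    fix x
    have "(\<integral>t. indicator {0..L} t * w x * d (x + t *\<^sub>R e) \<partial>lborel)
        = (\<integral>t. w x * (indicator {0..L} t * d (x + t *\<^sub>R e)) \<partial>lborel)"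
      by (simp only: mult_ac)
    then show "(\<integral>t. indicator {0..L} t * w x * d (x + t *\<^sub>R e) \<partial>lborel)
        = w x * (\<integral>t. indicator {0..L} t * d (x + t *\<^sub>R e) \<partial>lborel)" by simp
  qed
  finally show ?thesis by (simp add: ftc)
qed

section \<open>Test functions and the weak divergence of ray integrals\<close>

text \<open>Off the closed support \<phi> vanishes on an open set, so its derivative vanishes there
  too. Bounds then follow from continuity on the compact support.\<close>

lemma test_fun_facts:
  fixes \<phi> :: "'a::euclidean_space \<Rightarrow> real"
  assumes "test_fun \<Omega> \<phi>"
  shows test_fun_has_derivative: "\<And>x. (\<phi> has_derivative frechet_derivative \<phi> (at x)) (at x)"
    and test_fun_continuous: "continuous_on UNIV \<phi>"
    and test_fun_eq_0: "\<And>x. x \<notin> \<Omega> \<Longrightarrow> \<phi> x = 0"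
    and test_fun_derivative_eq_0: "\<And>x. x \<notin> \<Omega> \<Longrightarrow> frechet_derivative \<phi> (at x) = (\<lambda>h. 0)"
    and test_fun_derivative_continuous:
      "\<And>i. i \<in> Basis \<Longrightarrow> continuous_on UNIV (\<lambda>x. frechet_derivative \<phi> (at x) i)"
    and test_fun_bounded: "\<exists>C. \<forall>x. \<bar>\<phi> x\<bar> \<le> C"
    and test_fun_derivative_bounded: "\<And>i. i \<in> Basis \<Longrightarrow> \<exists>C. \<forall>x. \<bar>frechet_derivative \<phi> (at x) i\<bar> \<le> C"
proof -
  define K where "K = closure {x. \<phi> x \<noteq> 0}"
  have K: "compact K" "K \<subseteq> \<Omega>" and Ck: "Ck k \<phi> UNIV" for k
    using assms by (auto simp: test_fun_def smooth_fun_def K_def)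
  have diff: "\<phi> differentiable_on UNIV"
    and cont': "\<And>i. i \<in> Basis \<Longrightarrow> continuous_on UNIV (\<lambda>x. frechet_derivative \<phi> (at x) i)"
    using Ck[of "Suc 0"] by auto
  then show deriv: "(\<phi> has_derivative frechet_derivative \<phi> (at x)) (at x)" for x
    by (simp add: differentiable_on_def frechet_derivative_works)
  show cont: "continuous_on UNIV \<phi>" using Ck[of 0] by simp
  have zero: "\<phi> x = 0" if "x \<notin> K" for x
    using that closure_subset[of "{x. \<phi> x \<noteq> 0}"] by (auto simp: K_def)
  have zero': "frechet_derivative \<phi> (at x) = (\<lambda>h. 0)" if "x \<notin> K" for x
  proof -
    have "((\<lambda>x. 0) has_derivative (\<lambda>h. 0)) (at x)" by simp
    then have "(\<phi> has_derivative (\<lambda>h. 0)) (at x)"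
      by (rule has_derivative_transform_within_open[of _ _ _ _ "- K"])
         (use that K(1) zero in \<open>auto simp: compact_imp_closed open_Compl\<close>)
    then show ?thesis by (metis frechet_derivative_at)
  qed
  show "\<phi> x = 0" "frechet_derivative \<phi> (at x) = (\<lambda>h. 0)" if "x \<notin> \<Omega>" for x
    using that K(2) zero zero' by auto
  have bnd: "\<exists>C. \<forall>x. \<bar>f x\<bar> \<le> C" if "continuous_on UNIV f" "\<And>x. x \<notin> K \<Longrightarrow> f x = 0" for f :: "'a \<Rightarrow> real"
  proof -
    have "bounded (f ` K)"
      using that(1) K(1) by (intro compact_imp_bounded compact_continuous_image) (auto intro: continuous_on_subset)
    then obtain C where "\<forall>x\<in>K. \<bar>f x\<bar> \<le> C" by (auto simp: bounded_iff)
    then have "\<bar>f x\<bar> \<le> max C 0" for x using that(2) by (cases "x \<in> K") (auto simp: le_max_iff_disj)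
    then show ?thesis by blast
  qed
  show "\<exists>C. \<forall>x. \<bar>\<phi> x\<bar> \<le> C" by (rule bnd[OF cont zero])
  show "\<And>i. i \<in> Basis \<Longrightarrow> continuous_on UNIV (\<lambda>x. frechet_derivative \<phi> (at x) i)" by (rule cont')
  show "\<exists>C. \<forall>x. \<bar>frechet_derivative \<phi> (at x) i\<bar> \<le> C" if "i \<in> Basis" for i
    by (rule bnd[OF cont'[OF that]]) (simp add: zero')
qed

text \<open>In the integration by parts the term at the far end drops out: where \<open>w\<close> is
  nonzero the point lies in \<Omega>, so \<open>x + L *\<^sub>R e\<close> is outside and \<phi>
  vanishes there. What remains is the defining identity of the weak divergence.\<close>

lemma weak_div_ray_integral:
  fixes \<Omega> :: "'a::euclidean_space set"
  assumes \<Omega>: "open \<Omega>" and L: "L > 0" and e: "e \<in> Basis"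
    and far: "\<And>x. x \<in> \<Omega> \<Longrightarrow> x + L *\<^sub>R e \<notin> \<Omega>"
    and w[measurable]: "w \<in> borel_measurable borel" and w_int: "integrable lborel w"
    and w0: "\<And>x. x \<notin> \<Omega> \<Longrightarrow> w x = 0"
  shows "weak_div \<Omega> (\<lambda>x. ray_integral L e w x *\<^sub>R e) w"
  unfolding weak_div_def
proof (intro allI impI)
  fix \<phi> :: "'a \<Rightarrow> real" assume \<phi>: "test_fun \<Omega> \<phi>"
  define D where "D x = frechet_derivative \<phi> (at x)" for x
  note [measurable] = borel_measurable_ray_integral[OF w]
  have [measurable]: "\<phi> \<in> borel_measurable borel" "(\<lambda>x. D x e) \<in> borel_measurable borel"
    using test_fun_continuous[OF \<phi>] test_fun_derivative_continuous[OF \<phi> e]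
    by (auto simp: D_def intro: borel_measurable_continuous_onI)
  have \<Omega>_sets: "\<Omega> \<inter> space lebesgue \<in> sets lebesgue" using \<Omega> by auto
  have lin: "D x (a *\<^sub>R e) = a * D x e" for x a
    using linear_cmul[OF has_derivative_linear[OF test_fun_has_derivative[OF \<phi>, of x]]] by (simp add: D_def)
  obtain C where C: "\<And>x. \<bar>D x e\<bar> \<le> C"
    using test_fun_derivative_bounded[OF \<phi> e] by (auto simp: D_def)
  have on_\<Omega>: "(\<integral>x. f x \<partial>lebesgue_on \<Omega>) = (\<integral>x. f x \<partial>lborel)"
    if "\<And>x. x \<notin> \<Omega> \<Longrightarrow> f x = 0" "f \<in> borel_measurable borel" for f :: "'a \<Rightarrow> real"
  proof -
    have "(\<integral>x. f x \<partial>lebesgue_on \<Omega>) = (\<integral>x. indicator \<Omega> x *\<^sub>R f x \<partial>lebesgue)"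
      by (rule integral_restrict_space[OF \<Omega>_sets])
    also have "\<dots> = (\<integral>x. f x \<partial>lebesgue)"
      by (rule Bochner_Integration.integral_cong) (auto simp: that(1) split: split_indicator)
    also have "\<dots> = (\<integral>x. f x \<partial>lborel)" by (rule integral_completion) (use that in auto)
    finally show ?thesis .
  qed
  have "(\<integral>x. D x (ray_integral L e w x *\<^sub>R e) \<partial>lebesgue_on \<Omega>) = (\<integral>x. ray_integral L e w x * D x e \<partial>lborel)"
    unfolding lin using test_fun_derivative_eq_0[OF \<phi>] by (intro on_\<Omega>) (auto simp: D_def[symmetric])
  also have "\<dots> = (\<integral>x. w x * (\<phi> (x + L *\<^sub>R e) - \<phi> x) \<partial>lborel)"
    using test_fun_has_derivative[OF \<phi>] test_fun_derivative_continuous[OF \<phi> e] C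
    by (intro ray_integral_integral_by_parts L w w_int) (auto simp: D_def)
  also have "\<dots> = (\<integral>x. - (w x * \<phi> x) \<partial>lborel)"
  proof (rule Bochner_Integration.integral_cong[OF refl])
    fix x
    show "w x * (\<phi> (x + L *\<^sub>R e) - \<phi> x) = - (w x * \<phi> x)"
      using far[of x] test_fun_eq_0[OF \<phi>, of "x + L *\<^sub>R e"] w0[of x] by (cases "x \<in> \<Omega>") auto
  qed
  also have "\<dots> = - (\<integral>x. w x * \<phi> x \<partial>lebesgue_on \<Omega>)"
    by (subst on_\<Omega>) (auto simp: w0)
  finally show "(\<integral>x. frechet_derivative \<phi> (at x) (ray_integral L e w x *\<^sub>R e) \<partial>lebesgue_on \<Omega>)
      = - (\<integral>x. w x * \<phi> x \<partial>lebesgue_on \<Omega>)"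
    by (simp add: D_def)
qed

lemma weak_div_right_inverse:
  fixes \<Omega> :: "'a::euclidean_space set"
  assumes \<Omega>: "open \<Omega>" "bounded \<Omega>" and s: "s > 1"
  shows "\<exists>L>0. \<forall>w. Lp \<Omega> s w \<longrightarrow>
    (\<exists>v. Lp \<Omega> s v \<and> weak_div \<Omega> v w \<and> Lnorm \<Omega> s v \<le> L * Lnorm \<Omega> s w)"
proof (intro exI[of _ "diameter \<Omega> + 1"] conjI allI impI)
  \<comment> \<open>The summand 1 makes the shift strictly longer than the diameter, so no two
    points of \<Omega> differ by it, and keeps \<open>L\<close> positive when the diameter is
    0.\<close>
  define L where "L = diameter \<Omega> + 1"
  have L: "L > 0" using diameter_ge_0[OF \<Omega>(2)] by (simp add: L_def)
  then show "diameter \<Omega> + 1 > 0" by (simp add: L_def)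
  obtain e :: 'a where e: "e \<in> Basis" using nonempty_Basis by blast
  have far: "x + L *\<^sub>R e \<notin> \<Omega>" if "x \<in> \<Omega>" for x
    using diameter_bounded_bound[OF \<Omega>(2) that, of "x + L *\<^sub>R e"] e L by (auto simp: L_def dist_norm)
  have \<Omega>_sets: "\<Omega> \<inter> space lebesgue \<in> sets lebesgue" and [measurable]: "\<Omega> \<in> sets borel" using \<Omega> by auto
  fix w :: "'a \<Rightarrow> real" assume w: "Lp \<Omega> s w"
  define H where "H x = indicator \<Omega> x *\<^sub>R w x" for x
  have H: "H \<in> borel_measurable lebesgue"
    using w borel_measurable_restrict_space_iff[OF \<Omega>_sets, of w] by (simp add: Lp_def H_def[abs_def])
  \<comment> \<open>Ray integrals are taken of a Borel function: \<open>w1\<close> represents the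
    extension of \<open>w\<close> by zero, and cutting it off once more makes \<open>w0\<close>
    vanish everywhere outside \<Omega>, not just almost everywhere.\<close>
  obtain w1 where w1[measurable]: "w1 \<in> borel_measurable lborel" and ae1: "AE x in lborel. H x = w1 x"
    using completion_ex_borel_measurable_real[OF H] by blast
  define w0 where "w0 x = indicator \<Omega> x * w1 x" for x
  have w0[measurable]: "w0 \<in> borel_measurable borel" unfolding w0_def[abs_def] by measurable
  have w0_zero: "w0 x = 0" if "x \<notin> \<Omega>" for x using that by (simp add: w0_def)
  have "AE x in lborel. x \<in> \<Omega> \<longrightarrow> w x = w0 x"
    using ae1 by eventually_elim (auto simp: H_def w0_def)
  then have ae: "AE x in lebesgue_on \<Omega>. w x = w0 x"
    using AE_restrict_space_iff[OF \<Omega>_sets] AE_completion by blast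
  have w0_meas: "w0 \<in> borel_measurable (lebesgue_on \<Omega>)"
    by (intro measurable_restrict_space1 measurable_completion) simp
  have w_meas: "w \<in> borel_measurable (lebesgue_on \<Omega>)" using w by (simp add: Lp_def)
  have pow_eq: "(\<lambda>x. indicator \<Omega> x *\<^sub>R \<bar>w0 x\<bar> powr s) = (\<lambda>x. \<bar>w0 x\<bar> powr s)"
    by (auto simp: fun_eq_iff w0_zero split: split_indicator)
  have "integrable (lebesgue_on \<Omega>) (\<lambda>x. \<bar>w0 x\<bar> powr s)"
    using w by (subst integrable_cong_AE[where g = "\<lambda>x. \<bar>w x\<bar> powr s"])
      (use ae w0_meas w_meas in \<open>auto simp: Lp_def\<close>)
  then have "integrable lebesgue (\<lambda>x. \<bar>w0 x\<bar> powr s)"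
    by (subst (asm) integrable_restrict_space[OF \<Omega>_sets]) (simp add: pow_eq del: real_scaleR_def)
  then have w0_pow: "integrable lborel (\<lambda>x. \<bar>w0 x\<bar> powr s)"
    by (subst (asm) integrable_completion) auto
  have "(\<integral>x. \<bar>w x\<bar> powr s \<partial>lebesgue_on \<Omega>) = (\<integral>x. \<bar>w0 x\<bar> powr s \<partial>lebesgue_on \<Omega>)"
    using ae w0_meas w_meas by (intro integral_cong_AE) auto
  also have "\<dots> = (\<integral>x. \<bar>w0 x\<bar> powr s \<partial>lebesgue)"
    by (subst integral_restrict_space[OF \<Omega>_sets]) (simp add: pow_eq del: real_scaleR_def)
  also have "\<dots> = (\<integral>x. \<bar>w0 x\<bar> powr s \<partial>lborel)"
    by (rule integral_completion) simp
  finally have w_pow_eq: "(\<integral>x. \<bar>w x\<bar> powr s \<partial>lebesgue_on \<Omega>) = (\<integral>x. \<bar>w0 x\<bar> powr s \<partial>lborel)" .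
  have w0_int: "integrable lborel w0"
  proof (rule Bochner_Integration.integrable_bound)
    show "integrable lborel (\<lambda>x. indicat_real \<Omega> x + \<bar>w0 x\<bar> powr s)"
      using w0_pow emeasure_bounded_finite[OF \<Omega>(2)] by (intro Bochner_Integration.integrable_add) auto
    \<comment> \<open>With \<Omega> of finite measure this turns integrability of the s-th power
      into integrability of \<open>w0\<close> itself.\<close>
    have "\<bar>t\<bar> \<le> 1 + \<bar>t\<bar> powr s" for t :: real
    proof (cases "\<bar>t\<bar> \<le> 1")
      case True then show ?thesis by (simp add: add_increasing2)
    next
      case False
      then have "\<bar>t\<bar> powr 1 \<le> \<bar>t\<bar> powr s" using s by (intro powr_mono) auto
      then show ?thesis using False by simp
    qed
    then show "AE x in lborel. norm (w0 x) \<le> norm (indicat_real \<Omega> x + \<bar>w0 x\<bar> powr s)"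
      by (intro always_eventually allI) (auto simp: w0_zero split: split_indicator)
  qed simp
  define V where "V = ray_integral L e w0"
  have V_meas: "V \<in> borel_measurable lborel"
    using borel_measurable_ray_integral[OF w0] by (simp add: V_def)
  note V_pow = ray_integral_Lp[OF s L w0 w0_pow, of e, folded V_def]
  have V_pow_leb: "integrable lebesgue (\<lambda>x. \<bar>V x\<bar> powr s)"
    using V_pow(1) V_meas by (subst integrable_completion) auto
  have V_ind: "integrable lebesgue (\<lambda>x. indicator \<Omega> x *\<^sub>R \<bar>V x\<bar> powr s)"
    by (rule integrable_mult_indicator[OF _ V_pow_leb]) (use \<Omega> in auto)
  have norm_V: "norm (V x *\<^sub>R e) = \<bar>V x\<bar>" for x using e by simp
  have Lp_V: "Lp \<Omega> s (\<lambda>x. V x *\<^sub>R e)"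
    unfolding Lp_def norm_V
  proof
    show "(\<lambda>x. V x *\<^sub>R e) \<in> borel_measurable (lebesgue_on \<Omega>)"
      using V_meas by (intro measurable_restrict_space1 measurable_completion) simp
    show "integrable (lebesgue_on \<Omega>) (\<lambda>x. \<bar>V x\<bar> powr s)"
      using V_ind by (subst integrable_restrict_space[OF \<Omega>_sets])
  qed
  moreover have "weak_div \<Omega> (\<lambda>x. V x *\<^sub>R e) w"
  proof -
    have "weak_div \<Omega> (\<lambda>x. V x *\<^sub>R e) w0"
      unfolding V_def using \<Omega>(1) L e far w0 w0_int w0_zero by (rule weak_div_ray_integral)
    \<comment> \<open>A weak divergence may be altered on a null set, which leads back from
      \<open>w0\<close> to \<open>w\<close>.\<close>
    moreover have "(\<integral>x. w0 x * \<phi> x \<partial>lebesgue_on \<Omega>) = (\<integral>x. w x * \<phi> x \<partial>lebesgue_on \<Omega>)"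
      if "test_fun \<Omega> \<phi>" for \<phi>
    proof (rule integral_cong_AE)
      have "\<phi> \<in> borel_measurable (lebesgue_on \<Omega>)"
        using borel_measurable_continuous_onI[OF test_fun_continuous[OF that]]
        by (intro measurable_restrict_space1 measurable_completion) simp
      then show "(\<lambda>x. w0 x * \<phi> x) \<in> borel_measurable (lebesgue_on \<Omega>)"
        "(\<lambda>x. w x * \<phi> x) \<in> borel_measurable (lebesgue_on \<Omega>)"
        using w0_meas w_meas by auto
      show "AE x in lebesgue_on \<Omega>. w0 x * \<phi> x = w x * \<phi> x"
        using ae by eventually_elim simp
    qed
    ultimately show ?thesis by (simp add: weak_div_def)
  qed
  moreover have "Lnorm \<Omega> s (\<lambda>x. V x *\<^sub>R e) \<le> L * Lnorm \<Omega> s w"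
  proof -
    have "(\<integral>x. \<bar>V x\<bar> powr s \<partial>lebesgue_on \<Omega>) = (\<integral>x. indicator \<Omega> x *\<^sub>R \<bar>V x\<bar> powr s \<partial>lebesgue)"
      by (rule integral_restrict_space[OF \<Omega>_sets])
    also have "\<dots> \<le> (\<integral>x. \<bar>V x\<bar> powr s \<partial>lebesgue)"
      using V_ind V_pow_leb by (intro integral_mono) (auto split: split_indicator)
    also have "\<dots> = (\<integral>x. \<bar>V x\<bar> powr s \<partial>lborel)"
      using V_meas by (intro integral_completion) simp
    also have "\<dots> \<le> L powr s * (\<integral>x. \<bar>w x\<bar> powr s \<partial>lebesgue_on \<Omega>)"
      using V_pow(2) by (simp add: w_pow_eq)
    finally have "(\<integral>x. \<bar>V x\<bar> powr s \<partial>lebesgue_on \<Omega>) powr (1 / s)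
        \<le> (L powr s * (\<integral>x. \<bar>w x\<bar> powr s \<partial>lebesgue_on \<Omega>)) powr (1 / s)"
      using s by (intro powr_mono2) auto
    then show ?thesis
      using s L by (simp only: Lnorm_def norm_V real_norm_def) (simp add: powr_mult powr_powr)
  qed
  ultimately show "\<exists>v. Lp \<Omega> s v \<and> weak_div \<Omega> v w \<and> Lnorm \<Omega> s v \<le> (diameter \<Omega> + 1) * Lnorm \<Omega> s w"
    by (auto simp: L_def)
qed

section \<open>The spaces V and W and their duals\<close>

lemma wdiv_spec:
  assumes "v \<in> Vsp \<Omega> s"
  shows "Lp \<Omega> s (wdiv \<Omega> s v)" "weak_div \<Omega> v (wdiv \<Omega> s v)"
proof -
  have "\<exists>g. Lp \<Omega> s g \<and> weak_div \<Omega> v g" using assms by (simp add: Vsp_def)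
  from someI_ex[OF this] show "Lp \<Omega> s (wdiv \<Omega> s v)" "weak_div \<Omega> v (wdiv \<Omega> s v)"
    by (auto simp: wdiv_def)
qed

lemma Lp_imp_integrable:
  fixes g :: "'a::euclidean_space \<Rightarrow> real"
  assumes "\<Omega> \<in> lmeasurable" "s > 1" "Lp \<Omega> s g"
  shows "integrable (lebesgue_on \<Omega>) g"
  using Lp_inclusion(1)[OF assms(1) _ assms(2,3)] by (auto simp: Lp_def integrable_abs_iff)

text \<open>The difference \<open>g - h\<close> integrates to zero against every test function, and
  it is integrable because an L^s function on a set of finite measure is.\<close>

lemma weak_div_unique:
  fixes \<Omega> :: "'a::euclidean_space set"
  assumes \<Omega>: "open \<Omega>" "bounded \<Omega>" and s: "s > 1"
    and g: "Lp \<Omega> s g" "weak_div \<Omega> v g" and h: "Lp \<Omega> s h" "weak_div \<Omega> v h"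
  shows "AE x in lebesgue_on \<Omega>. g x = h x"
proof -
  have lm: "\<Omega> \<in> lmeasurable" using \<Omega> by (simp add: lmeasurable_open)
  have int: "integrable (lebesgue_on \<Omega>) g" "integrable (lebesgue_on \<Omega>) h"
    using Lp_imp_integrable[OF lm s] g h by auto
  have "AE x in lebesgue_on \<Omega>. g x - h x = 0"
  proof (rule fundamental_lemma_calculus_of_variations[OF \<Omega>(1)])
    show "integrable (lebesgue_on \<Omega>) (\<lambda>x. g x - h x)" using int by simp
    fix \<phi> :: "'a \<Rightarrow> real" assume \<phi>: "test_fun \<Omega> \<phi>"
    obtain C where C: "\<And>x. \<bar>\<phi> x\<bar> \<le> C" using test_fun_bounded[OF \<phi>] by blast
    have meas: "\<phi> \<in> borel_measurable (lebesgue_on \<Omega>)"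
      using borel_measurable_continuous_onI[OF test_fun_continuous[OF \<phi>]]
      by (intro measurable_restrict_space1 measurable_completion) simp
    have int_mult: "integrable (lebesgue_on \<Omega>) (\<lambda>x. f x * \<phi> x)" if "integrable (lebesgue_on \<Omega>) f" for f :: "'a \<Rightarrow> real"
    proof (rule Bochner_Integration.integrable_bound)
      show "integrable (lebesgue_on \<Omega>) (\<lambda>x. f x * C)" using that by simp
      show "(\<lambda>x. f x * \<phi> x) \<in> borel_measurable (lebesgue_on \<Omega>)" using that meas by auto
      show "AE x in lebesgue_on \<Omega>. norm (f x * \<phi> x) \<le> norm (f x * C)"
      proof (intro always_eventually allI)
        fix x
        have "\<bar>\<phi> x\<bar> \<le> \<bar>C\<bar>" using C[of x] by simp
        then show "norm (f x * \<phi> x) \<le> norm (f x * C)" by (simp add: abs_mult mult_left_mono)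
      qed
    qed
    have "(\<integral>x. g x * \<phi> x \<partial>lebesgue_on \<Omega>) = (\<integral>x. h x * \<phi> x \<partial>lebesgue_on \<Omega>)"
      using g(2) h(2) \<phi> by (simp add: weak_div_def)
    then show "(\<integral>x. (g x - h x) * \<phi> x \<partial>lebesgue_on \<Omega>) = 0"
      using int_mult[OF int(1)] int_mult[OF int(2)] by (simp add: left_diff_distrib)
  qed
  then show ?thesis by simp
qed

lemma weak_div_scaleR:
  fixes v :: "'a::euclidean_space \<Rightarrow> 'a"
  assumes "weak_div \<Omega> v g"
  shows "weak_div \<Omega> (\<lambda>x. a *\<^sub>R v x) (\<lambda>x. a * g x)"
  unfolding weak_div_def
proof (intro allI impI)
  fix \<phi> :: "'a \<Rightarrow> real" assume \<phi>: "test_fun \<Omega> \<phi>"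
  have "frechet_derivative \<phi> (at x) (a *\<^sub>R v x) = a * frechet_derivative \<phi> (at x) (v x)" for x
    using linear_cmul[OF has_derivative_linear[OF test_fun_has_derivative[OF \<phi>, of x]]] by simp
  then show "(\<integral>x. frechet_derivative \<phi> (at x) (a *\<^sub>R v x) \<partial>lebesgue_on \<Omega>)
      = - (\<integral>x. a * g x * \<phi> x \<partial>lebesgue_on \<Omega>)"
    using assms \<phi> by (simp add: weak_div_def mult.assoc)
qed

lemma Vsp_scaleR:
  assumes "v \<in> Vsp \<Omega> s"
  shows "(\<lambda>x. a *\<^sub>R v x) \<in> Vsp \<Omega> s"
proof -
  have "Lp \<Omega> s (\<lambda>x. a *\<^sub>R v x)" "Lp \<Omega> s (\<lambda>x. a *\<^sub>R wdiv \<Omega> s v x)"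
    using assms wdiv_spec[OF assms] by (auto simp: Vsp_def intro!: Lp_scaleR simp del: real_scaleR_def)
  moreover have "weak_div \<Omega> (\<lambda>x. a *\<^sub>R v x) (\<lambda>x. a *\<^sub>R wdiv \<Omega> s v x)"
    using weak_div_scaleR[OF wdiv_spec(2)[OF assms], of a] by simp
  ultimately show ?thesis unfolding Vsp_def by blast
qed

lemma wdiv_AE_eq:
  assumes "open \<Omega>" "bounded \<Omega>" "s > 1" "Lp \<Omega> s v" "Lp \<Omega> s g" "weak_div \<Omega> v g"
  shows "AE x in lebesgue_on \<Omega>. wdiv \<Omega> s v x = g x"
proof -
  have "v \<in> Vsp \<Omega> s" using assms by (auto simp: Vsp_def)
  from weak_div_unique[OF assms(1-3) wdiv_spec[OF this] assms(5,6)] show ?thesis .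
qed

lemma Lnorm_wdiv_eq:
  assumes "open \<Omega>" "bounded \<Omega>" "s > 1" "Lp \<Omega> s v" "Lp \<Omega> s g" "weak_div \<Omega> v g"
  shows "Lnorm \<Omega> s (wdiv \<Omega> s v) = Lnorm \<Omega> s g"
proof (rule Lnorm_cong_AE)
  have "v \<in> Vsp \<Omega> s" using assms by (auto simp: Vsp_def)
  then show "wdiv \<Omega> s v \<in> borel_measurable (lebesgue_on \<Omega>)"
    using wdiv_spec by (auto simp: Lp_def)
  show "g \<in> borel_measurable (lebesgue_on \<Omega>)" using assms(5) by (simp add: Lp_def)
  show "AE x in lebesgue_on \<Omega>. norm (wdiv \<Omega> s v x) = norm (g x)"
    using wdiv_AE_eq[OF assms] by eventually_elim simp
qed

text \<open>The divergence chosen for the multiple and the multiple of the chosen divergence may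
  differ as functions, but only on a null set, which the norm does not see.\<close>

lemma Vnorm_scaleR:
  assumes "open \<Omega>" "bounded \<Omega>" "s > 1" "v \<in> Vsp \<Omega> s"
  shows "Vnorm \<Omega> s (\<lambda>x. a *\<^sub>R v x) = \<bar>a\<bar> * Vnorm \<Omega> s v"
proof -
  have "Lnorm \<Omega> s (wdiv \<Omega> s (\<lambda>x. a *\<^sub>R v x)) = Lnorm \<Omega> s (\<lambda>x. a *\<^sub>R wdiv \<Omega> s v x)"
  proof (rule Lnorm_wdiv_eq[OF assms(1-3)])
    show "Lp \<Omega> s (\<lambda>x. a *\<^sub>R v x)" using assms(4) by (intro Lp_scaleR) (simp add: Vsp_def)
    show "Lp \<Omega> s (\<lambda>x. a *\<^sub>R wdiv \<Omega> s v x)" using wdiv_spec[OF assms(4)] by (intro Lp_scaleR)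
    show "weak_div \<Omega> (\<lambda>x. a *\<^sub>R v x) (\<lambda>x. a *\<^sub>R wdiv \<Omega> s v x)"
      using weak_div_scaleR[OF wdiv_spec(2)[OF assms(4)], of a] by simp
  qed
  also have "\<dots> = \<bar>a\<bar> * Lnorm \<Omega> s (wdiv \<Omega> s v)"
    using assms by (intro Lnorm_scaleR) auto
  finally have "Vnorm \<Omega> s (\<lambda>x. a *\<^sub>R v x)
      = (\<bar>a\<bar> powr s * (Lnorm \<Omega> s v powr s + Lnorm \<Omega> s (wdiv \<Omega> s v) powr s)) powr (1 / s)"
    using assms by (simp add: Vnorm_def Lnorm_scaleR powr_mult Lnorm_nonneg distrib_left)
  also have "\<dots> = \<bar>a\<bar> * Vnorm \<Omega> s v"
    unfolding Vnorm_def using assms by (subst powr_mult) (auto simp: powr_powr)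
  finally show ?thesis .
qed

lemma weak_div_zero: "weak_div \<Omega> (\<lambda>x. 0) (\<lambda>x. 0)"
  unfolding weak_div_def
proof (intro allI impI)
  fix \<phi> :: "'a \<Rightarrow> real" assume \<phi>: "test_fun \<Omega> \<phi>"
  have "frechet_derivative \<phi> (at x) 0 = 0" for x
    using linear_0[OF has_derivative_linear[OF test_fun_has_derivative[OF \<phi>, of x]]] .
  then show "(\<integral>x. frechet_derivative \<phi> (at x) 0 \<partial>lebesgue_on \<Omega>) = - (\<integral>x. 0 * \<phi> x \<partial>lebesgue_on \<Omega>)"
    by simp
qed

lemma Vsp_zero: "(\<lambda>x. 0) \<in> Vsp \<Omega> s"
  unfolding Vsp_def using weak_div_zero[of \<Omega>] by (auto simp: Lp_zero intro!: exI[of _ "\<lambda>x. 0"])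

lemma Vnorm_nonneg: "0 \<le> Vnorm \<Omega> s v"
  by (simp add: Vnorm_def)

lemma Vnorm_zero:
  assumes "open \<Omega>" "bounded \<Omega>" "s > 1"
  shows "Vnorm \<Omega> s (\<lambda>x. 0) = 0"
  using Vnorm_scaleR[OF assms Vsp_zero, of 0] by simp

text \<open>Write t^s as t t^(s-1) and enlarge the second factor to (a+b)^(s-1). This lets the norm
  of V be replaced by the plain sum of its two parts.\<close>

lemma powr_sum_root_le:
  fixes a b s :: real
  assumes "a \<ge> 0" "b \<ge> 0" "s > 1"
  shows "(a powr s + b powr s) powr (1 / s) \<le> a + b"
proof -
  have *: "t powr s = t * t powr (s - 1)" if "t \<ge> 0" for t
    using that powr_mult_base[of t "s - 1"] by simp
  have "a powr s + b powr s \<le> a * (a + b) powr (s - 1) + b * (a + b) powr (s - 1)"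
    unfolding *[OF assms(1)] *[OF assms(2)]
    using assms by (intro add_mono mult_left_mono powr_mono2) auto
  also have "\<dots> = (a + b) powr s" using *[of "a + b"] assms by (simp add: distrib_right)
  finally have "(a powr s + b powr s) powr (1 / s) \<le> ((a + b) powr s) powr (1 / s)"
    using assms by (intro powr_mono2) auto
  then show ?thesis using assms by (simp add: powr_powr)
qed

lemma Vnorm_le: "s > 1 \<Longrightarrow> Vnorm \<Omega> s v \<le> Lnorm \<Omega> s v + Lnorm \<Omega> s (wdiv \<Omega> s v)"
  unfolding Vnorm_def by (intro powr_sum_root_le Lnorm_nonneg)

section \<open>Bounded functionals and their partial norms\<close>

lemma Wdual_scaleR:
  assumes "G \<in> Wdual \<Omega> s" "(v, q) \<in> Wsp \<Omega> s"
  shows "G (\<lambda>x. a *\<^sub>R v x, \<lambda>x. a * q x) = a * G (v, q)"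
proof -
  have "\<forall>v1 q1 v2 q2 a b. (v1, q1) \<in> Wsp \<Omega> s \<longrightarrow> (v2, q2) \<in> Wsp \<Omega> s \<longrightarrow>
        G (\<lambda>x. a *\<^sub>R v1 x + b *\<^sub>R v2 x, \<lambda>x. a * q1 x + b * q2 x) = a * G (v1, q1) + b * G (v2, q2)"
    using assms(1) by (simp add: Wdual_def)
  from this[rule_format, OF assms(2) assms(2), of a 0] show ?thesis by simp
qed

lemma Wdual_zero:
  assumes "G \<in> Wdual \<Omega> s"
  shows "G (\<lambda>x. 0, \<lambda>x. 0) = 0"
  using Wdual_scaleR[OF assms, of "\<lambda>x. 0" "\<lambda>x. 0" 0] Vsp_zero Lp_zero by (auto simp: Wsp_def)

lemma Wdual_bounded:
  assumes "G \<in> Wdual \<Omega> s"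
  obtains C where "C \<ge> 0" "\<And>w. w \<in> Wsp \<Omega> s \<Longrightarrow> \<bar>G w\<bar> \<le> C * Wnorm \<Omega> s w"
proof -
  obtain C where C: "\<And>w. w \<in> Wsp \<Omega> s \<Longrightarrow> \<bar>G w\<bar> \<le> C * Wnorm \<Omega> s w"
    using assms unfolding Wdual_def by blast
  have "\<bar>G w\<bar> \<le> \<bar>C\<bar> * Wnorm \<Omega> s w" if "w \<in> Wsp \<Omega> s" for w
    using C[OF that] mult_right_mono[OF abs_ge_self, of "Wnorm \<Omega> s w" C]
    by (simp add: Wnorm_def Vnorm_nonneg Lnorm_nonneg)
  then show ?thesis using that[of "\<bar>C\<bar>"] by simp
qed

text \<open>A real \<open>Sup\<close> is an upper bound only for sets bounded above; this justifies
  treating the dual norms as suprema.\<close>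

lemma Wdual_bdd_above:
  assumes "G \<in> Wdual \<Omega> s"
  shows "bdd_above ((\<lambda>w. \<bar>G w\<bar>) ` {w\<in>Wsp \<Omega> s. Wnorm \<Omega> s w \<le> 1})"
proof -
  obtain C where C: "C \<ge> 0" "\<And>w. w \<in> Wsp \<Omega> s \<Longrightarrow> \<bar>G w\<bar> \<le> C * Wnorm \<Omega> s w"
    using Wdual_bounded[OF assms] by metis
  have "\<bar>G w\<bar> \<le> C" if "w \<in> Wsp \<Omega> s" "Wnorm \<Omega> s w \<le> 1" for w
    using C(2)[OF that(1)] mult_left_le[OF that(2) C(1)] by simp
  then show ?thesis by (intro bdd_aboveI[of _ C]) auto
qed

lemma Wdual_norm_upper:
  assumes "G \<in> Wdual \<Omega> s" "w \<in> Wsp \<Omega> s" "Wnorm \<Omega> s w \<le> 1"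
  shows "\<bar>G w\<bar> \<le> Wdual_norm \<Omega> s G"
  unfolding Wdual_norm_def using assms by (intro cSUP_upper Wdual_bdd_above) auto

lemma pi1_unit_ball:
  assumes "v \<in> Vsp \<Omega> s" "Vnorm \<Omega> s v \<le> 1"
  shows "(v, \<lambda>x. 0) \<in> Wsp \<Omega> s" "Wnorm \<Omega> s (v, \<lambda>x. 0) \<le> 1"
  using assms by (auto simp: Wsp_def Wnorm_def Lp_zero Lnorm_zero)

lemma pi2_unit_ball:
  assumes "open \<Omega>" "bounded \<Omega>" "s > 1" "Lp \<Omega> (conj_exp s) q" "Lnorm \<Omega> (conj_exp s) q \<le> 1"
  shows "(\<lambda>x. 0, q) \<in> Wsp \<Omega> s" "Wnorm \<Omega> s (\<lambda>x. 0, q) \<le> 1"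
  using assms by (auto simp: Wsp_def Wnorm_def Vsp_zero Vnorm_zero)

lemma pi1_norm_le_Wdual_norm:
  assumes "G \<in> Wdual \<Omega> s" "open \<Omega>" "bounded \<Omega>" "s > 1"
  shows "pi1_norm \<Omega> s G \<le> Wdual_norm \<Omega> s G"
  unfolding pi1_norm_def
proof (rule cSUP_least)
  show "{v \<in> Vsp \<Omega> s. Vnorm \<Omega> s v \<le> 1} \<noteq> {}"
    using Vsp_zero[of \<Omega> s] Vnorm_zero[OF assms(2-4)] by (auto intro!: exI[of _ "\<lambda>x. 0"])
qed (use assms pi1_unit_ball in \<open>auto intro!: Wdual_norm_upper\<close>)

lemma pi2_norm_le_Wdual_norm:
  fixes \<Omega> :: "'a::euclidean_space set"
  assumes "G \<in> Wdual \<Omega> s" "open \<Omega>" "bounded \<Omega>" "s > 1"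
  shows "pi2_norm \<Omega> s G \<le> Wdual_norm \<Omega> s G"
  unfolding pi2_norm_def
proof (rule cSUP_least)
  show "{q :: 'a \<Rightarrow> real. Lp \<Omega> (conj_exp s) q \<and> Lnorm \<Omega> (conj_exp s) q \<le> 1} \<noteq> {}"
    by (auto simp: Lp_zero Lnorm_zero intro!: exI[of _ "\<lambda>x. 0::real"])
qed (use assms pi2_unit_ball in \<open>auto intro!: Wdual_norm_upper\<close>)

text \<open>Rescale to the unit ball. Elements are functions, not classes, so the norm can vanish
  for a nonzero \<open>v\<close>; then boundedness of \<open>G\<close> forces
  \<open>G (v, \<lambda>x. 0)\<close> to be 0.\<close>

lemma pi1_norm_bound:
  assumes G: "G \<in> Wdual \<Omega> s" and \<Omega>: "open \<Omega>" "bounded \<Omega>" "s > 1" and v: "v \<in> Vsp \<Omega> s"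
  shows "\<bar>G (v, \<lambda>x. 0)\<bar> \<le> pi1_norm \<Omega> s G * Vnorm \<Omega> s v"
proof (cases "Vnorm \<Omega> s v = 0")
  case True
  obtain C where "\<And>w. w \<in> Wsp \<Omega> s \<Longrightarrow> \<bar>G w\<bar> \<le> C * Wnorm \<Omega> s w"
    using Wdual_bounded[OF G] by blast
  from this[of "(v, \<lambda>x. 0)"] show ?thesis
    using True v by (simp add: Wsp_def Wnorm_def Lp_zero Lnorm_zero)
next
  case False
  then have pos: "Vnorm \<Omega> s v > 0" using Vnorm_nonneg[of \<Omega> s v] by simp
  define a where "a = inverse (Vnorm \<Omega> s v)"
  have av: "(\<lambda>x. a *\<^sub>R v x) \<in> Vsp \<Omega> s" "Vnorm \<Omega> s (\<lambda>x. a *\<^sub>R v x) \<le> 1"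
    using v Vsp_scaleR Vnorm_scaleR[OF \<Omega> v] pos by (auto simp: a_def)
  have "bdd_above ((\<lambda>v. \<bar>G (v, \<lambda>x. 0)\<bar>) ` {v \<in> Vsp \<Omega> s. Vnorm \<Omega> s v \<le> 1})"
    by (intro bdd_aboveI[of _ "Wdual_norm \<Omega> s G"]) (use pi1_unit_ball G in \<open>auto intro!: Wdual_norm_upper\<close>)
  then have "\<bar>G (\<lambda>x. a *\<^sub>R v x, \<lambda>x. 0)\<bar> \<le> pi1_norm \<Omega> s G"
    unfolding pi1_norm_def using av by (intro cSUP_upper2[of _ _ "\<lambda>x. a *\<^sub>R v x"]) auto
  moreover have "G (\<lambda>x. a *\<^sub>R v x, \<lambda>x. 0) = a * G (v, \<lambda>x. 0)"
    using Wdual_scaleR[OF G, of v "\<lambda>x. 0" a] v by (simp add: Wsp_def Lp_zero)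
  moreover have "a > 0" "Vnorm \<Omega> s v * a = 1" using pos by (simp_all add: a_def)
  ultimately have "a * \<bar>G (v, \<lambda>x. 0)\<bar> \<le> pi1_norm \<Omega> s G" by (simp add: abs_mult)
  then have "Vnorm \<Omega> s v * (a * \<bar>G (v, \<lambda>x. 0)\<bar>) \<le> Vnorm \<Omega> s v * pi1_norm \<Omega> s G"
    using pos by (intro mult_left_mono) auto
  with \<open>Vnorm \<Omega> s v * a = 1\<close> show ?thesis
    by (simp flip: mult.assoc) (simp add: mult.commute)
qed

lemma pi2_norm_upper:
  assumes G: "G \<in> Wdual \<Omega> s" and \<Omega>: "open \<Omega>" "bounded \<Omega>" "s > 1"
    and q: "Lp \<Omega> (conj_exp s) q" "Lnorm \<Omega> (conj_exp s) q \<le> 1"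
  shows "\<bar>G (\<lambda>x. 0, q)\<bar> \<le> pi2_norm \<Omega> s G"
proof -
  have "bdd_above ((\<lambda>q. \<bar>G (\<lambda>x. 0, q)\<bar>) ` {q. Lp \<Omega> (conj_exp s) q \<and> Lnorm \<Omega> (conj_exp s) q \<le> 1})"
    by (intro bdd_aboveI[of _ "Wdual_norm \<Omega> s G"])
       (use pi2_unit_ball[OF \<Omega>] G in \<open>auto intro!: Wdual_norm_upper\<close>)
  then show ?thesis
    unfolding pi2_norm_def using q by (intro cSUP_upper) auto
qed

lemma pi1_norm_nonneg:
  assumes "G \<in> Wdual \<Omega> s" "open \<Omega>" "bounded \<Omega>" "s > 1"
  shows "0 \<le> pi1_norm \<Omega> s G"
proof -
  have "bdd_above ((\<lambda>v. \<bar>G (v, \<lambda>x. 0)\<bar>) ` {v \<in> Vsp \<Omega> s. Vnorm \<Omega> s v \<le> 1})"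
    by (intro bdd_aboveI[of _ "Wdual_norm \<Omega> s G"]) (use pi1_unit_ball assms in \<open>auto intro!: Wdual_norm_upper\<close>)
  then show ?thesis
    unfolding pi1_norm_def using Vsp_zero Vnorm_zero[OF assms(2-4)]
    by (intro cSUP_upper2[of _ _ "\<lambda>x. 0"]) auto
qed

lemma pi2_norm_nonneg:
  assumes "G \<in> Wdual \<Omega> s" "open \<Omega>" "bounded \<Omega>" "s > 1"
  shows "0 \<le> pi2_norm \<Omega> s G"
  using pi2_norm_upper[OF assms, of "\<lambda>x. 0"] by (simp add: Lp_zero Lnorm_zero)

section \<open>A priori estimates\<close>

text \<open>The exponents lie on either side of 1, so one of the two powers dominates
  \<open>t\<close>. This absorbs the linear terms \<gamma> and \<Phi>.\<close>

lemma le_powr_add_powr: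
  fixes t s :: real
  assumes "t \<ge> 0" "s > 2"
  shows "t \<le> t powr (1 / (s - 1)) + t powr (s - 1)"
proof (cases "t \<le> 1")
  case True
  then have "t powr 1 \<le> t powr (1 / (s - 1))" using assms by (intro powr_mono') auto
  then show ?thesis using assms by (simp add: add_increasing2)
next
  case False
  then have "t powr 1 \<le> t powr (s - 1)" using assms by (intro powr_mono) auto
  then show ?thesis using False by (simp add: add_increasing)
qed

text \<open>To be read with t = \<gamma>, y = \<gamma>^(r-1), z = \<gamma>^(s-1), x = \<beta>^(r-1)
  and b = \<beta>; the sum \<open>y + z + x + b\<close> is the quantity bounding the
  pressure.\<close>

lemma sum4_bounds:
  fixes b t x y z :: real
  assumes "t \<le> y + z" "0 \<le> x" "0 \<le> y" "0 \<le> z" "0 \<le> b"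
  shows "t \<le> y + z + x + b" "x + y + t \<le> 2 * (y + z + x + b)" "b + t + z \<le> 2 * (y + z + x + b)"
  using assms by simp_all

lemma powr_sum3_le:
  fixes a b c m :: real
  assumes "a \<ge> 0" "b \<ge> 0" "c \<ge> 0" "m > 0"
  shows "(a + b + c) powr m \<le> 3 powr m * (a powr m + b powr m + c powr m)"
proof -
  define M where "M = max a (max b c)"
  have "(a + b + c) powr m \<le> (3 * M) powr m"
    using assms by (intro powr_mono2) (auto simp: M_def)
  also have "\<dots> = 3 powr m * M powr m"
    using assms by (simp add: M_def powr_mult)
  also have "M powr m \<le> a powr m + b powr m + c powr m"
    by (auto simp: M_def max_def)
  finally show ?thesis by simp
qed

text \<open>Either N \<le> M and nothing is left to prove, or M < N and every product on the right
  of the energy inequality is at most M N^(s-1); division by N^(s-1) then finishes. Both \<beta> and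
  \<gamma> are at most M^(s-1), because \<open>M\<close> contains their roots of order s-1.\<close>

lemma scalar_velocity_estimate:
  fixes s K c2 N D P \<beta> \<gamma> :: real
  assumes s: "s > 2" and K: "K > 0" and c2: "c2 > 0" and nn: "N \<ge> 0" "D \<ge> 0" "\<beta> \<ge> 0" and D: "D \<le> \<gamma>"
    and P: "P \<le> K * (N + N powr (s - 1) + \<beta>)" and energy: "c2 * N powr s \<le> \<beta> * (N + D) + D * P"
  shows "N \<le> max 1 ((2 + 3 * K) / c2) * (\<beta> powr (1 / (s - 1)) + \<gamma> powr (1 / (s - 1)) + \<gamma>)"
proof -
  define M where "M = \<beta> powr (1 / (s - 1)) + \<gamma> powr (1 / (s - 1)) + \<gamma>"
  have \<gamma>: "\<gamma> \<ge> 0" using nn D by simp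
  then have M: "M \<ge> 0" by (simp add: M_def)
  have "N \<le> max 1 ((2 + 3 * K) / c2) * M"
  proof (cases "N \<le> M")
    case True
    then show ?thesis using M mult_right_mono[of 1 "max 1 ((2 + 3 * K) / c2)" M] by simp
  next
    case False
    then have N: "N > 0" "M \<le> N" using M by auto
    have root: "t \<le> M powr (s - 1)" if "t \<ge> 0" "t powr (1 / (s - 1)) \<le> M" for t
    proof -
      have "(t powr (1 / (s - 1))) powr (s - 1) \<le> M powr (s - 1)"
        using that s by (intro powr_mono2) auto
      then show ?thesis using that s by (simp add: powr_powr)
    qed
    have le_M: "\<beta> powr (1 / (s - 1)) \<le> M" "\<gamma> powr (1 / (s - 1)) \<le> M" and \<gamma>M': "\<gamma> \<le> M"
      using \<gamma> by (auto simp: M_def)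
    have \<beta>M: "\<beta> \<le> M powr (s - 1)" and \<gamma>M: "\<gamma> \<le> M powr (s - 1)"
      by (rule root[OF nn(3) le_M(1)], rule root[OF \<gamma> le_M(2)])
    define X where "X = M * N powr (s - 1)"
    have split: "t powr (s - 1) = t * t powr (s - 2)" if "t \<ge> 0" for t
      using that powr_mult_base[of t "s - 2"] by simp
    \<comment> \<open>Splitting off M^(s-2) and replacing it by N^(s-2) uses s > 2 and M \<le>
      N.\<close>
    have "M powr (s - 1) * N \<le> X"
    proof -
      have "M powr (s - 2) * (M * N) \<le> N powr (s - 2) * (M * N)"
        using N M s by (intro mult_right_mono powr_mono2) auto
      then show ?thesis using M N by (simp add: X_def split mult_ac)
    qed
    then have 1: "\<beta> * N \<le> X" "\<gamma> * N \<le> X"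
      using mult_right_mono[OF \<beta>M nn(1)] mult_right_mono[OF \<gamma>M nn(1)] by simp_all
    have 2: "\<beta> * \<gamma> \<le> X"
    proof -
      have "\<beta> * \<gamma> \<le> N powr (s - 1) * M"
      proof (intro mult_mono)
        show "\<beta> \<le> N powr (s - 1)"
          using \<beta>M N M s powr_mono2[of "s - 1" M N] by auto
      qed (use \<gamma>M' \<gamma> in auto)
      then show ?thesis by (simp add: X_def mult.commute)
    qed
    have 3: "\<gamma> * N powr (s - 1) \<le> X" unfolding X_def using \<gamma>M' by (intro mult_right_mono) auto
    have "D * P \<le> D * (K * (N + N powr (s - 1) + \<beta>))" using P nn by (intro mult_left_mono)
    also have "\<dots> \<le> \<gamma> * (K * (N + N powr (s - 1) + \<beta>))"
      using D K nn by (intro mult_right_mono) auto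
    also have "\<dots> = K * (\<gamma> * N + \<gamma> * N powr (s - 1) + \<beta> * \<gamma>)" by (simp add: algebra_simps)
    also have "\<dots> \<le> K * (X + X + X)" using K 1 2 3 by (intro mult_left_mono add_mono) auto
    finally have "D * P \<le> 3 * K * X" by simp
    moreover have "\<beta> * (N + D) \<le> X + X"
      using 1(1) 2 mult_left_mono[OF D nn(3)] by (simp add: distrib_left)
    \<comment> \<open>The 2 counts \<beta> N and \<beta> D; the 3 K comes from the three products
      that arise when the bound for \<open>P\<close> is multiplied by \<open>D\<close>.\<close>
    ultimately have "c2 * N powr s \<le> (2 + 3 * K) * X" using energy by (simp add: algebra_simps)
    moreover have "N powr s = N * N powr (s - 1)" using N powr_mult_base[of N "s - 1"] by simp
    ultimately have "c2 * N * N powr (s - 1) \<le> (2 + 3 * K) * M * N powr (s - 1)"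
      by (simp add: X_def mult_ac)
    then have "c2 * N \<le> (2 + 3 * K) * M" using N by simp
    then have "N \<le> (2 + 3 * K) / c2 * M" using c2 by (simp add: field_simps)
    also have "\<dots> \<le> max 1 ((2 + 3 * K) / c2) * M" using M by (intro mult_right_mono) auto
    finally show ?thesis .
  qed
  then show ?thesis by (simp add: M_def)
qed

text \<open>The velocity bound is inserted into the pressure bound. In the constant, 2 k accounts
  for N, the power of 3 k for N^(s-1), and 1 for \<beta>.\<close>

lemma scalar_pressure_estimate:
  fixes s K k N P \<beta> \<gamma> :: real
  assumes s: "s > 2" and K: "K > 0" and k: "k \<ge> 1" and nn: "N \<ge> 0" "\<beta> \<ge> 0" "\<gamma> \<ge> 0"
    and P: "P \<le> K * (N + N powr (s - 1) + \<beta>)"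
    and N: "N \<le> k * (\<beta> powr (1 / (s - 1)) + \<gamma> powr (1 / (s - 1)) + \<gamma>)"
  shows "P \<le> K * (2 * k + 2 * (k * 3) powr (s - 1) + 1)
    * (\<gamma> powr (1 / (s - 1)) + \<gamma> powr (s - 1) + \<beta> powr (1 / (s - 1)) + \<beta>)"
proof -
  define Q where "Q = \<gamma> powr (1 / (s - 1)) + \<gamma> powr (s - 1) + \<beta> powr (1 / (s - 1)) + \<beta>"
  define M where "M = \<beta> powr (1 / (s - 1)) + \<gamma> powr (1 / (s - 1)) + \<gamma>"
  have \<gamma>le: "\<gamma> \<le> \<gamma> powr (1 / (s - 1)) + \<gamma> powr (s - 1)" using nn s by (intro le_powr_add_powr)
  have MQ: "M \<le> 2 * Q" unfolding M_def Q_def using \<gamma>le nn by (intro sum4_bounds(2)) auto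
  have NQ: "N \<le> 2 * k * Q"
    using order_trans[OF N[folded M_def] mult_left_mono[OF MQ]] k by simp
  have "N powr (s - 1) \<le> (k * M) powr (s - 1)"
    using N nn s by (intro powr_mono2) (auto simp: M_def)
  also have "\<dots> = k powr (s - 1) * M powr (s - 1)"
    using k nn by (simp add: powr_mult M_def)
  \<comment> \<open>The power s-1 cancels the exponent 1/(s-1) on \<beta> and \<gamma> and turns the
    linear \<gamma> into \<gamma>^(s-1).\<close>
  also have "M powr (s - 1) \<le> 3 powr (s - 1) * (\<beta> + \<gamma> + \<gamma> powr (s - 1))"
    using powr_sum3_le[of "\<beta> powr (1 / (s - 1))" "\<gamma> powr (1 / (s - 1))" \<gamma> "s - 1"] nn s
    by (simp add: M_def powr_powr)
  also have "\<beta> + \<gamma> + \<gamma> powr (s - 1) \<le> 2 * Q"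
    unfolding Q_def using \<gamma>le nn by (intro sum4_bounds(3)) auto
  finally have NsQ: "N powr (s - 1) \<le> 2 * (k * 3) powr (s - 1) * Q"
    using k by (simp add: powr_mult mult_ac mult_left_mono)
  have \<beta>Q: "\<beta> \<le> Q" using nn by (simp add: Q_def)
  have "P \<le> K * (2 * k * Q + 2 * (k * 3) powr (s - 1) * Q + Q)"
    by (rule order_trans[OF P]) (use K NQ NsQ \<beta>Q in \<open>intro mult_left_mono add_mono; simp\<close>)
  also have "\<dots> = K * (2 * k + 2 * (k * 3) powr (s - 1) + 1) * Q" by (simp add: algebra_simps)
  finally show ?thesis by (simp add: Q_def)
qed

section \<open>The nonlinear form\<close>

text \<open>Continuity is needed so that \<open>F\<close> is Borel and \<open>F (u x)\<close> is
  measurable in x.\<close>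

lemma growth_continuous:
  fixes F :: "'a::euclidean_space \<Rightarrow> 'a"
  assumes "s > 2"
    and F: "\<And>x y. norm (F x - F y) \<le> c1 * (1 + norm x powr (s - 2) + norm y powr (s - 2)) * norm (x - y)"
  shows "continuous_on UNIV F"
proof -
  have "isCont F y" for y
  proof -
    have "((\<lambda>x. norm x powr (s - 2)) \<longlongrightarrow> norm y powr (s - 2)) (at y)"
      using assms(1) by (intro tendsto_powr' tendsto_norm tendsto_ident_at tendsto_const) auto
    then have "((\<lambda>x. c1 * (1 + norm x powr (s - 2) + norm y powr (s - 2)) * norm (x - y)) \<longlongrightarrow>
        c1 * (1 + norm y powr (s - 2) + norm y powr (s - 2)) * norm (y - y)) (at y)"
      by (intro tendsto_mult tendsto_add tendsto_diff tendsto_norm tendsto_ident_at tendsto_const)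
    then have lim: "((\<lambda>x. c1 * (1 + norm x powr (s - 2) + norm y powr (s - 2)) * norm (x - y)) \<longlongrightarrow> 0) (at y)"
      by simp
    have "((\<lambda>x. F x - F y) \<longlongrightarrow> 0) (at y)"
      by (rule Lim_null_comparison[OF always_eventually[OF allI[OF F]] lim])
    then have "(F \<longlongrightarrow> F y) (at y)" by (rule Lim_null[THEN iffD2])
    then show ?thesis by (simp add: isCont_def)
  qed
  then show ?thesis by (simp add: continuous_at_imp_continuous_on)
qed

text \<open>The growth condition at y = 0 gives |F(u)| \<le> c1 (|u| + |u|^(s-1)). The power
  |u|^(s-1) lies in L^r by homogeneity, whereas the linear term uses r < s and the finite measure of
  \<Omega>, whence the measure factor.\<close>

lemma form_a_integrable_bound:
  fixes F :: "'a::euclidean_space \<Rightarrow> 'a"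
  assumes \<Omega>: "\<Omega> \<in> lmeasurable" and s: "s > 2" and c1: "c1 > 0" and F0: "F 0 = 0"
    and F: "\<And>x y. norm (F x - F y) \<le> c1 * (1 + norm x powr (s - 2) + norm y powr (s - 2)) * norm (x - y)"
    and u: "Lp \<Omega> s u" and v: "Lp \<Omega> s v"
  shows "integrable (lebesgue_on \<Omega>) (\<lambda>x. F (u x) \<bullet> v x)"
    and "\<bar>form_a \<Omega> F u v\<bar> \<le> c1 * (measure lebesgue \<Omega> powr (1 / conj_exp s - 1 / s) + 1)
      * (Lnorm \<Omega> s u + Lnorm \<Omega> s u powr (s - 1)) * Lnorm \<Omega> s v"
proof -
  define r where "r = conj_exp s"
  define A where "A = measure lebesgue \<Omega> powr (1 / r - 1 / s)"
  have r: "r > 1" "s > 1" "1 / r + 1 / s = 1" "(s - 1) * r = s" "1 \<le> r" "r < s"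
    using conj_exp_props[of s] s by (auto simp: r_def conj_exp_def field_simps)
  define f where "f x = norm (u x) powr (s - 1)" for x
  have meas: "u \<in> borel_measurable (lebesgue_on \<Omega>)" "v \<in> borel_measurable (lebesgue_on \<Omega>)"
    using u v by (auto simp: Lp_def)
  have f_pow: "norm (f x) powr r = norm (u x) powr s" for x
    using r by (simp add: f_def powr_powr)
  have f: "Lp \<Omega> r f"
    using u meas unfolding Lp_def f_pow by (auto simp: f_def[abs_def])
  have "1 / r = (1 / s) * (s - 1)" using s by (simp add: r_def conj_exp_def)
  then have f_norm: "Lnorm \<Omega> r f = Lnorm \<Omega> s u powr (s - 1)"
    unfolding Lnorm_def f_pow by (simp add: powr_powr)
  have ur: "Lp \<Omega> r u" "Lnorm \<Omega> r u \<le> A * Lnorm \<Omega> s u"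
    using Lp_inclusion[OF \<Omega> r(5,6) u] by (auto simp: A_def)
  note H1 = Lp_Hoelder[OF r(1-3) ur(1) v]
  note H2 = Lp_Hoelder[OF r(1-3) f v]
  define h where "h x = c1 * (norm (u x) * norm (v x) + norm (f x) * norm (v x))" for x
  have h_int: "integrable (lebesgue_on \<Omega>) h"
    unfolding h_def[abs_def] using H1(1) H2(1) by simp
  have bound: "norm (F (u x) \<bullet> v x) \<le> h x" for x
  proof -
    have "norm (F (u x)) \<le> c1 * (1 + norm (u x) powr (s - 2)) * norm (u x)"
      using F[of "u x" 0] F0 s by simp
    also have "\<dots> = c1 * (norm (u x) + norm (f x))"
      using powr_mult_base[of "norm (u x)" "s - 2"] by (simp add: f_def algebra_simps)
    finally have "norm (F (u x)) * norm (v x) \<le> c1 * (norm (u x) + norm (f x)) * norm (v x)"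
      by (intro mult_right_mono) auto
    then show ?thesis
      using Cauchy_Schwarz_ineq2[of "F (u x)" "v x"] by (simp add: h_def algebra_simps)
  qed
  show "integrable (lebesgue_on \<Omega>) (\<lambda>x. F (u x) \<bullet> v x)"
  proof (rule Bochner_Integration.integrable_bound[OF h_int])
    have "F \<in> borel_measurable borel"
      by (rule borel_measurable_continuous_onI[OF growth_continuous[OF s F]])
    then show "(\<lambda>x. F (u x) \<bullet> v x) \<in> borel_measurable (lebesgue_on \<Omega>)"
      using meas by (intro borel_measurable_inner) (auto intro: measurable_compose)
    show "AE x in lebesgue_on \<Omega>. norm (F (u x) \<bullet> v x) \<le> norm (h x)"
      by (intro always_eventually allI) (use bound in \<open>auto intro: order_trans[OF _ abs_ge_self]\<close>)
  qed
  have "\<bar>form_a \<Omega> F u v\<bar> \<le> (\<integral>x. norm (F (u x) \<bullet> v x) \<partial>lebesgue_on \<Omega>)"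
    unfolding form_a_def real_norm_def[symmetric] by (rule integral_norm_bound)
  also have "\<dots> \<le> (\<integral>x. h x \<partial>lebesgue_on \<Omega>)"
    by (rule integral_mono'[OF h_int bound]) (use order_trans[OF norm_ge_zero bound] in auto)
  also have "\<dots> = c1 * ((\<integral>x. norm (u x) * norm (v x) \<partial>lebesgue_on \<Omega>) + (\<integral>x. norm (f x) * norm (v x) \<partial>lebesgue_on \<Omega>))"
    unfolding h_def using H1(1) H2(1) by simp
  also have "\<dots> \<le> c1 * (A * Lnorm \<Omega> s u * Lnorm \<Omega> s v + Lnorm \<Omega> s u powr (s - 1) * Lnorm \<Omega> s v)"
    using c1 H2(2) order_trans[OF H1(2) mult_right_mono[OF ur(2) Lnorm_nonneg]]
    by (intro mult_left_mono add_mono) (auto simp: f_norm)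
  also have "\<dots> \<le> c1 * ((A + 1) * (Lnorm \<Omega> s u + Lnorm \<Omega> s u powr (s - 1)) * Lnorm \<Omega> s v)"
  proof (intro mult_left_mono)
    have "A \<ge> 0" by (simp add: A_def)
    then have "A * Lnorm \<Omega> s u + Lnorm \<Omega> s u powr (s - 1) \<le> (A + 1) * (Lnorm \<Omega> s u + Lnorm \<Omega> s u powr (s - 1))"
      using Lnorm_nonneg[of \<Omega> s u] by (simp add: algebra_simps)
    from mult_right_mono[OF this Lnorm_nonneg[of \<Omega> s v]]
    show "A * Lnorm \<Omega> s u * Lnorm \<Omega> s v + Lnorm \<Omega> s u powr (s - 1) * Lnorm \<Omega> s v
        \<le> (A + 1) * (Lnorm \<Omega> s u + Lnorm \<Omega> s u powr (s - 1)) * Lnorm \<Omega> s v"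
      by (simp add: distrib_right)
  qed (use c1 in auto)
  finally show "\<bar>form_a \<Omega> F u v\<bar> \<le> c1 * (measure lebesgue \<Omega> powr (1 / conj_exp s - 1 / s) + 1)
      * (Lnorm \<Omega> s u + Lnorm \<Omega> s u powr (s - 1)) * Lnorm \<Omega> s v"
    by (simp add: A_def r_def mult.assoc)
qed

lemma form_a_coercive:
  fixes F :: "'a::euclidean_space \<Rightarrow> 'a"
  assumes s: "s > 2" and F0: "F 0 = 0" and mono: "\<And>x y. (F x - F y) \<bullet> (x - y) \<ge> c2 * norm (x - y) powr s"
    and u: "Lp \<Omega> s u" and int: "integrable (lebesgue_on \<Omega>) (\<lambda>x. F (u x) \<bullet> u x)"
  shows "c2 * Lnorm \<Omega> s u powr s \<le> form_a \<Omega> F u u"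
proof -
  have "c2 * Lnorm \<Omega> s u powr s = (\<integral>x. c2 * norm (u x) powr s \<partial>lebesgue_on \<Omega>)"
    using s by (simp add: Lnorm_powr)
  also have "\<dots> \<le> (\<integral>x. F (u x) \<bullet> u x \<partial>lebesgue_on \<Omega>)"
    using u int mono[of _ 0] F0 by (intro integral_mono) (auto simp: Lp_def)
  finally show ?thesis by (simp add: form_a_def)
qed

section \<open>Testing the equation\<close>

lemma solves_momentum:
  assumes "solves \<Omega> s F (u, p) G" "v \<in> Vsp \<Omega> s"
  shows "G (v, \<lambda>x. 0) = form_a \<Omega> F u v - form_b \<Omega> s v p"
proof -
  have "(v, \<lambda>x. 0) \<in> Wsp \<Omega> s" using assms(2) by (simp add: Wsp_def Lp_zero)
  with assms(1) have "opA \<Omega> s F (u, p) (v, \<lambda>x. 0) = G (v, \<lambda>x. 0)" unfolding solves_def by blast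
  then show ?thesis by (simp add: opA_def form_b_def)
qed

text \<open>
  The term \<open>form_b \<Omega> s 0 p\<close> vanishes because linearity of \<open>G\<close> forces \<open>G (0, 0) = 0\<close>.
\<close>

lemma solves_mass:
  assumes "solves \<Omega> s F (u, p) G" "G \<in> Wdual \<Omega> s" "Lp \<Omega> (conj_exp s) q"
  shows "G (\<lambda>x. 0, q) = form_b \<Omega> s u q"
proof -
  have "form_b \<Omega> s (\<lambda>x. 0) p = 0"
    using solves_momentum[OF assms(1) Vsp_zero] Wdual_zero[OF assms(2)] by (simp add: form_a_def)
  moreover have "(\<lambda>x. 0, q) \<in> Wsp \<Omega> s" using assms(3) by (simp add: Wsp_def Vsp_zero)
  with assms(1) have "opA \<Omega> s F (u, p) (\<lambda>x. 0, q) = G (\<lambda>x. 0, q)" unfolding solves_def by blast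
  ultimately show ?thesis by (simp add: opA_def form_a_def)
qed

lemma divergence_estimate:
  assumes \<Omega>: "open \<Omega>" "bounded \<Omega>" "s > 1" and G: "G \<in> Wdual \<Omega> s" and u: "u \<in> Vsp \<Omega> s"
    and sol: "solves \<Omega> s F (u, p) G"
  shows "Lnorm \<Omega> s (wdiv \<Omega> s u) \<le> pi2_norm \<Omega> s G"
proof -
  define g where "g = wdiv \<Omega> s u"
  define D where "D = Lnorm \<Omega> s g"
  have g: "Lp \<Omega> s g" using wdiv_spec(1)[OF u] by (simp add: g_def)
  show ?thesis
  proof (cases "D = 0")
    case True
    then show ?thesis using pi2_norm_nonneg[OF G \<Omega>] by (simp add: D_def g_def)
  next
    case False
    then have D: "D > 0" using Lnorm_nonneg[of \<Omega> s g] by (simp add: D_def)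
    note dual = Lp_duality_map[OF \<Omega>(3) g, folded D_def]
    \<comment> \<open>The dual function of \<open>g\<close> has norm D^(s-1), so this factor places
      \<open>q\<close> in the unit ball, where the supremum defining \<open>pi2_norm\<close> applies
      directly.\<close>
    define a where "a = inverse (D powr (s - 1))"
    define q where "q x = a *\<^sub>R duality_map s (g x)" for x
    have q: "Lp \<Omega> (conj_exp s) q"
      unfolding q_def[abs_def] by (rule Lp_scaleR[OF dual(1)])
    have "Lnorm \<Omega> (conj_exp s) q = \<bar>a\<bar> * D powr (s - 1)"
      unfolding q_def[abs_def] using conj_exp_props(1)[OF \<Omega>(3)] dual(2) by (subst Lnorm_scaleR) auto
    then have "Lnorm \<Omega> (conj_exp s) q \<le> 1" using D by (simp add: a_def)
    from pi2_norm_upper[OF G \<Omega> q this] have "\<bar>form_b \<Omega> s u q\<bar> \<le> pi2_norm \<Omega> s G"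
      using solves_mass[OF sol G q] by simp
    also have "form_b \<Omega> s u q = (\<integral>x. a * (g x * duality_map s (g x)) \<partial>lebesgue_on \<Omega>)"
      unfolding form_b_def g_def[symmetric] q_def by (simp only: real_scaleR_def mult_ac)
    also have "\<dots> = a * D powr s"
      using dual(3) by simp
    also have "a * D powr s = D"
      using D powr_mult_base[of D "s - 1"] by (simp add: a_def field_simps)
    finally show ?thesis using D by (simp add: D_def g_def)
  qed
qed

text \<open>With the divergence of \<open>v\<close> dual to \<open>p\<close>, the form b(v, p)
  equals P^r, while all other terms carry the factor P^(r-1); cancelling it leaves a bound linear in
  the data. The constant \<open>A\<close> stays abstract because it will depend on the norm of
  \<open>u\<close>.\<close>

lemma pressure_estimate:
  fixes \<Omega> :: "'a::euclidean_space set"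
  assumes \<Omega>: "open \<Omega>" "bounded \<Omega>" "s > 1" and G: "G \<in> Wdual \<Omega> s" and p: "Lp \<Omega> (conj_exp s) p"
    and sol: "solves \<Omega> s F (u, p) G" and L: "L > 0"
    and inv: "\<And>w. Lp \<Omega> s w \<Longrightarrow> \<exists>v. Lp \<Omega> s v \<and> weak_div \<Omega> v w \<and> Lnorm \<Omega> s v \<le> L * Lnorm \<Omega> s w"
    and a: "\<And>v. Lp \<Omega> s v \<Longrightarrow> \<bar>form_a \<Omega> F u v\<bar> \<le> A * Lnorm \<Omega> s v" and A: "A \<ge> 0"
  shows "Lnorm \<Omega> (conj_exp s) p \<le> A * L + pi1_norm \<Omega> s G * (L + 1)"
proof -
  define r where "r = conj_exp s"
  define P where "P = Lnorm \<Omega> r p"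
  have r: "r > 1" "conj_exp r = s" using conj_exp_props[OF \<Omega>(3)] by (auto simp: r_def)
  note dual = Lp_duality_map[OF r(1), of \<Omega> p, unfolded r(2), folded P_def, OF p[folded r_def]]
  define w where "w x = duality_map r (p x)" for x
  have w: "Lp \<Omega> s w" "Lnorm \<Omega> s w = P powr (r - 1)"
    using dual(1,2) by (auto simp: w_def[abs_def])
  obtain v where v: "Lp \<Omega> s v" "weak_div \<Omega> v w" "Lnorm \<Omega> s v \<le> L * P powr (r - 1)"
    using inv[OF w(1)] w(2) by auto
  have vV: "v \<in> Vsp \<Omega> s" using v w by (auto simp: Vsp_def)
  \<comment> \<open>Here \<open>L\<close> stands for the field itself and 1 for its divergence,
    whose norm is exactly P^(r-1).\<close>
  have "Vnorm \<Omega> s v \<le> (L + 1) * P powr (r - 1)"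
    using Vnorm_le[OF \<Omega>(3), of \<Omega> v] Lnorm_wdiv_eq[OF \<Omega> v(1) w(1) v(2)] v(3) w(2)
    by (simp add: distrib_right)
  then have "pi1_norm \<Omega> s G * Vnorm \<Omega> s v \<le> pi1_norm \<Omega> s G * ((L + 1) * P powr (r - 1))"
    using pi1_norm_nonneg[OF G \<Omega>] by (rule mult_left_mono)
  with pi1_norm_bound[OF G \<Omega> vV]
  have Gv: "\<bar>G (v, \<lambda>x. 0)\<bar> \<le> pi1_norm \<Omega> s G * (L + 1) * P powr (r - 1)" by simp
  have av: "\<bar>form_a \<Omega> F u v\<bar> \<le> A * L * P powr (r - 1)"
    using order_trans[OF a[OF v(1)] mult_left_mono[OF v(3) A]] by simp
  \<comment> \<open>The chosen divergence of \<open>v\<close> agrees with \<open>w\<close> only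
    almost everywhere, which suffices under the integral.\<close>
  have "form_b \<Omega> s v p = (\<integral>x. p x * duality_map r (p x) \<partial>lebesgue_on \<Omega>)"
    unfolding form_b_def
  proof (rule integral_cong_AE)
    show "(\<lambda>x. wdiv \<Omega> s v x * p x) \<in> borel_measurable (lebesgue_on \<Omega>)"
      "(\<lambda>x. p x * duality_map r (p x)) \<in> borel_measurable (lebesgue_on \<Omega>)"
      using wdiv_spec(1)[OF vV] p w(1) by (auto simp: Lp_def w_def[abs_def])
    show "AE x in lebesgue_on \<Omega>. wdiv \<Omega> s v x * p x = p x * duality_map r (p x)"
      using wdiv_AE_eq[OF \<Omega> v(1) w(1) v(2)] by eventually_elim (simp add: w_def)
  qed
  also have "\<dots> = P powr r" by (rule dual(3))
  finally have "P powr r \<le> (A * L + pi1_norm \<Omega> s G * (L + 1)) * P powr (r - 1)"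
    using solves_momentum[OF sol vV] av Gv by (simp add: distrib_right)
  moreover have "P \<ge> 0" by (simp add: P_def Lnorm_nonneg)
  moreover have "P powr r = P * P powr (r - 1)" using powr_mult_base[OF \<open>P \<ge> 0\<close>, of "r - 1"] by simp
  moreover have "0 \<le> A * L + pi1_norm \<Omega> s G * (L + 1)"
    using A L pi1_norm_nonneg[OF G \<Omega>] by simp
  ultimately have "P \<le> A * L + pi1_norm \<Omega> s G * (L + 1)"
    by (cases "P = 0") auto
  then show ?thesis by (simp add: P_def r_def)
qed

text \<open>Testing with \<open>u\<close> itself leaves b(u, p), which has no sign because the
  divergence of \<open>u\<close> need not vanish; Hoelder's inequality turns it into the product
  that couples velocity and pressure.\<close>

lemma energy_estimate:
  assumes \<Omega>: "open \<Omega>" "bounded \<Omega>" "s > 1" and G: "G \<in> Wdual \<Omega> s" and u: "u \<in> Vsp \<Omega> s"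
    and p: "Lp \<Omega> (conj_exp s) p" and sol: "solves \<Omega> s F (u, p) G"
  shows "form_a \<Omega> F u u \<le> pi1_norm \<Omega> s G * (Lnorm \<Omega> s u + Lnorm \<Omega> s (wdiv \<Omega> s u))
    + Lnorm \<Omega> s (wdiv \<Omega> s u) * Lnorm \<Omega> (conj_exp s) p"
proof -
  note exps = \<Omega>(3) conj_exp_props(1,3)[OF \<Omega>(3)]
  have "\<bar>form_b \<Omega> s u p\<bar> \<le> (\<integral>x. norm (wdiv \<Omega> s u x * p x) \<partial>lebesgue_on \<Omega>)"
    unfolding form_b_def real_norm_def[symmetric] by (rule integral_norm_bound)
  also have "\<dots> \<le> Lnorm \<Omega> s (wdiv \<Omega> s u) * Lnorm \<Omega> (conj_exp s) p"
    using Lp_Hoelder(2)[OF exps wdiv_spec(1)[OF u] p] by (simp add: abs_mult)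
  finally have "\<bar>form_b \<Omega> s u p\<bar> \<le> Lnorm \<Omega> s (wdiv \<Omega> s u) * Lnorm \<Omega> (conj_exp s) p" .
  moreover have "\<bar>G (u, \<lambda>x. 0)\<bar> \<le> pi1_norm \<Omega> s G * (Lnorm \<Omega> s u + Lnorm \<Omega> s (wdiv \<Omega> s u))"
    using pi1_norm_bound[OF G \<Omega> u] mult_left_mono[OF Vnorm_le[OF \<Omega>(3)] pi1_norm_nonneg[OF G \<Omega>], of \<Omega> u]
    by simp
  ultimately show ?thesis using solves_momentum[OF sol u] by simp
qed

theorem mainTheorem17:
  fixes \<Omega> :: "'a::euclidean_space set" and F :: "'a \<Rightarrow> 'a" and s c1 c2 :: real
  assumes "DIM('a) \<ge> 2"
    and "open \<Omega>" and "bounded \<Omega>" and "C1_boundary \<Omega>"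
    and "s > 2" and "c1 > 0" and "c2 > 0"
    and "F 0 = 0"
    and "\<And>x y. norm (F x - F y) \<le> c1 * (1 + norm x powr (s - 2) + norm y powr (s - 2)) * norm (x - y)"
    and "\<And>x y. (F x - F y) \<bullet> (x - y) \<ge> c2 * norm (x - y) powr s"
  shows "\<exists>c7 c8 c9. c7 > 0 \<and> c8 > 0 \<and> c9 > 0 \<and>
    (\<forall>G u p. G \<in> Wdual \<Omega> s \<longrightarrow> (u, p) \<in> Wsp \<Omega> s \<longrightarrow> solves \<Omega> s F (u, p) G \<longrightarrow>
      (let r = conj_exp s; \<beta> = pi1_norm \<Omega> s G; \<gamma> = pi2_norm \<Omega> s G; \<Phi> = Wdual_norm \<Omega> s G in
        Lnorm \<Omega> s u \<le> c7 * (\<beta> powr (r - 1) + \<gamma> powr (r - 1) + \<gamma>)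
        \<and> Lnorm \<Omega> s (wdiv \<Omega> s u) \<le> c7 * \<gamma>
        \<and> Lnorm \<Omega> r p \<le> c7 * (\<gamma> powr (r - 1) + \<gamma> powr (s - 1) + \<beta> powr (r - 1) + \<beta>)
        \<and> Wnorm \<Omega> s (u, p) \<le> c8 * (\<gamma> powr (r - 1) + \<gamma> powr (s - 1) + \<beta> powr (r - 1) + \<beta>)
        \<and> Wnorm \<Omega> s (u, p) \<le> c9 * (\<Phi> powr (r - 1) + \<Phi> powr (s - 1))))"
proof -
  have s1: "s > 1" using \<open>s > 2\<close> by simp
  note \<Omega> = \<open>open \<Omega>\<close> \<open>bounded \<Omega>\<close> s1
  have lm: "\<Omega> \<in> lmeasurable" using \<Omega> by (simp add: lmeasurable_open)
  obtain L where L: "L > 0"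
    "\<And>w. Lp \<Omega> s w \<Longrightarrow> \<exists>v. Lp \<Omega> s v \<and> weak_div \<Omega> v w \<and> Lnorm \<Omega> s v \<le> L * Lnorm \<Omega> s w"
    using weak_div_right_inverse[OF \<Omega>] by blast
  define A where "A = c1 * (measure lebesgue \<Omega> powr (1 / conj_exp s - 1 / s) + 1)"
  have A: "A > 0" using \<open>c1 > 0\<close> by (auto simp: A_def intro!: mult_pos_pos add_nonneg_pos)
  \<comment> \<open>\<open>A * L\<close> multiplies N + N^(s-1) and \<open>L + 1\<close> multiplies
    \<beta> in the pressure estimate; their sum serves for both.\<close>
  define K where "K = A * L + (L + 1)"
  have K: "K > 0" using A L by (simp add: K_def add_pos_pos)
  define k where "k = max 1 ((2 + 3 * K) / c2)"
  have k: "k \<ge> 1" by (simp add: k_def)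
  \<comment> \<open>One constant for three bounds: \<open>k\<close> from the velocity, the long
    expression from the pressure, and c \<ge> 1 for the divergence.\<close>
  define c where "c = max k (K * (2 * k + 2 * (k * 3) powr (s - 1) + 1))"
  have c: "c \<ge> k" "c \<ge> 1" "c \<ge> K * (2 * k + 2 * (k * 3) powr (s - 1) + 1)" using k by (auto simp: c_def)
  show ?thesis
  \<comment> \<open>The 4 arises as 2 + 1 + 1 from velocity, divergence and pressure, each compared
    with \<open>Q\<close>; the further factor 3 comes from replacing \<beta> and \<gamma> by
    \<Phi>.\<close>
  proof (rule exI[of _ c], rule exI[of _ "4 * c"], rule exI[of _ "12 * c"], intro conjI allI impI)
    show "0 < c" "0 < 4 * c" "0 < 12 * c" using c by auto
    fix G u p
    assume G: "G \<in> Wdual \<Omega> s" and up: "(u, p) \<in> Wsp \<Omega> s" and sol: "solves \<Omega> s F (u, p) G"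
    have u: "u \<in> Vsp \<Omega> s" "Lp \<Omega> s u" and p: "Lp \<Omega> (conj_exp s) p"
      using up by (auto simp: Wsp_def Vsp_def)
    define \<rho> where "\<rho> = 1 / (s - 1)"
    define N where "N = Lnorm \<Omega> s u"
    define D where "D = Lnorm \<Omega> s (wdiv \<Omega> s u)"
    define P where "P = Lnorm \<Omega> (conj_exp s) p"
    define \<beta> where "\<beta> = pi1_norm \<Omega> s G"
    define \<gamma> where "\<gamma> = pi2_norm \<Omega> s G"
    define \<Phi> where "\<Phi> = Wdual_norm \<Omega> s G"
    have nn: "N \<ge> 0" "D \<ge> 0" "\<beta> \<ge> 0" "\<gamma> \<ge> 0"
      using Lnorm_nonneg pi1_norm_nonneg[OF G \<Omega>] pi2_norm_nonneg[OF G \<Omega>]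
      by (auto simp: N_def D_def \<beta>_def \<gamma>_def)
    have \<Phi>: "\<beta> \<le> \<Phi>" "\<gamma> \<le> \<Phi>"
      using pi1_norm_le_Wdual_norm[OF G \<Omega>] pi2_norm_le_Wdual_norm[OF G \<Omega>] by (auto simp: \<beta>_def \<gamma>_def \<Phi>_def)
    have D: "D \<le> \<gamma>" using divergence_estimate[OF \<Omega> G u(1) sol] by (simp add: D_def \<gamma>_def)
    note a = form_a_integrable_bound[OF lm \<open>s > 2\<close> \<open>c1 > 0\<close> \<open>F 0 = 0\<close> assms(9) u(2)]
    have P: "P \<le> K * (N + N powr (s - 1) + \<beta>)"
    proof -
      have "P \<le> A * (N + N powr (s - 1)) * L + \<beta> * (L + 1)"
        unfolding P_def \<beta>_def
        by (rule pressure_estimate[OF \<Omega> G p sol L]) (use a(2) A nn in \<open>auto simp: A_def N_def\<close>)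
      also have "\<dots> \<le> K * (N + N powr (s - 1)) + K * \<beta>"
      proof (rule add_mono)
        have "A * L * (N + N powr (s - 1)) \<le> K * (N + N powr (s - 1))"
          using L nn by (intro mult_right_mono) (auto simp: K_def)
        then show "A * (N + N powr (s - 1)) * L \<le> K * (N + N powr (s - 1))" by (simp add: mult_ac)
        have "(L + 1) * \<beta> \<le> K * \<beta>" using A L nn by (intro mult_right_mono) (auto simp: K_def)
        then show "\<beta> * (L + 1) \<le> K * \<beta>" by (simp add: mult.commute)
      qed
      finally show ?thesis by (simp add: distrib_left)
    qed
    have energy: "c2 * N powr s \<le> \<beta> * (N + D) + D * P"
      using form_a_coercive[OF \<open>s > 2\<close> \<open>F 0 = 0\<close> assms(10) u(2) a(1)[OF u(2)]]
        energy_estimate[OF \<Omega> G u(1) p sol]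
      by (simp add: N_def D_def P_def \<beta>_def)
    define M where "M = \<beta> powr \<rho> + \<gamma> powr \<rho> + \<gamma>"
    define Q where "Q = \<gamma> powr \<rho> + \<gamma> powr (s - 1) + \<beta> powr \<rho> + \<beta>"
    have Nk: "N \<le> k * M"
      using scalar_velocity_estimate[OF \<open>s > 2\<close> K \<open>c2 > 0\<close> nn(1-3) D P energy]
      by (simp add: k_def M_def \<rho>_def)
    have M0: "M \<ge> 0" and Q0: "Q \<ge> 0" using nn by (auto simp: M_def Q_def)
    have \<gamma>le: "\<gamma> \<le> \<gamma> powr \<rho> + \<gamma> powr (s - 1)"
      unfolding \<rho>_def using nn \<open>s > 2\<close> by (intro le_powr_add_powr)
    have MQ: "M \<le> 2 * Q" and \<gamma>Q: "\<gamma> \<le> Q"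
      unfolding M_def Q_def
      by (rule sum4_bounds[OF \<gamma>le powr_ge_zero powr_ge_zero powr_ge_zero nn(3)])+
    have Nc: "N \<le> c * M" using Nk mult_right_mono[OF c(1) M0] by simp
    have Dc: "D \<le> c * \<gamma>" using D mult_right_mono[OF c(2) nn(4)] by simp
    have Pc: "P \<le> c * Q"
      using scalar_pressure_estimate[OF \<open>s > 2\<close> K k nn(1,3,4) P] Nk mult_right_mono[OF c(3) Q0]
      by (simp add: M_def Q_def \<rho>_def)
    have W4: "Wnorm \<Omega> s (u, p) \<le> 4 * c * Q"
    proof -
      have "Wnorm \<Omega> s (u, p) \<le> N + D + P"
        using Vnorm_le[OF s1, of \<Omega> u] by (simp add: Wnorm_def N_def D_def P_def)
      also have "\<dots> \<le> c * (2 * Q) + c * Q + c * Q"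
        using c(2) order_trans[OF Nc mult_left_mono[OF MQ]] order_trans[OF Dc mult_left_mono[OF \<gamma>Q]] Pc
        by (intro add_mono) auto
      finally show ?thesis by (simp add: mult_ac)
    qed
    \<comment> \<open>Both partial norms are at most \<Phi> and all powers are increasing. The
      leftover linear \<Phi> is absorbed by the two powers, which gives the factor 3.\<close>
    have "Q \<le> \<Phi> powr \<rho> + \<Phi> powr (s - 1) + \<Phi> powr \<rho> + \<Phi>"
      unfolding Q_def using \<Phi> nn \<open>s > 2\<close> by (intro add_mono powr_mono2) (auto simp: \<rho>_def)
    also have "\<dots> \<le> 3 * (\<Phi> powr \<rho> + \<Phi> powr (s - 1))"
    proof -
      have *: "x + y + x + t \<le> 3 * (x + y)" if "t \<le> x + y" "0 \<le> y" for x y t :: real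
        using that by simp
      show ?thesis
        unfolding \<rho>_def using \<Phi> nn \<open>s > 2\<close> by (intro * le_powr_add_powr powr_ge_zero) auto
    qed
    finally have "4 * c * Q \<le> 4 * c * (3 * (\<Phi> powr \<rho> + \<Phi> powr (s - 1)))"
      using c(2) by (intro mult_left_mono) auto
    with W4 have W12: "Wnorm \<Omega> s (u, p) \<le> 12 * c * (\<Phi> powr \<rho> + \<Phi> powr (s - 1))"
      by (simp add: algebra_simps)
    have r: "conj_exp s - 1 = \<rho>" using conj_exp_props(4)[OF s1] by (simp add: \<rho>_def)
    show "let r = conj_exp s; \<beta> = pi1_norm \<Omega> s G; \<gamma> = pi2_norm \<Omega> s G; \<Phi> = Wdual_norm \<Omega> s G in
        Lnorm \<Omega> s u \<le> c * (\<beta> powr (r - 1) + \<gamma> powr (r - 1) + \<gamma>)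
        \<and> Lnorm \<Omega> s (wdiv \<Omega> s u) \<le> c * \<gamma>
        \<and> Lnorm \<Omega> r p \<le> c * (\<gamma> powr (r - 1) + \<gamma> powr (s - 1) + \<beta> powr (r - 1) + \<beta>)
        \<and> Wnorm \<Omega> s (u, p) \<le> 4 * c * (\<gamma> powr (r - 1) + \<gamma> powr (s - 1) + \<beta> powr (r - 1) + \<beta>)
        \<and> Wnorm \<Omega> s (u, p) \<le> 12 * c * (\<Phi> powr (r - 1) + \<Phi> powr (s - 1))"
      unfolding Let_def r
      using Nc Dc Pc W4 W12
      by (simp only: N_def D_def P_def M_def Q_def \<beta>_def \<gamma>_def \<Phi>_def simp_thms)
  qed
qed

end
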